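(* Let $n,n'\ge3$ and $m,m'\ge2$ be integers. Suppose $X\subseteq\mathcal T(n,m)$ is nonempty, invariant under $\mathrm{PSL}(2,\mathbb R)$ and closed, and $Y\subseteq\mathcal T(n',m')$ is nonempty, invariant under $\mathrm{PSL}(2,\mathbb R)$ and closed. If $m\ne m'$ then the actions of $\mathrm{PSL}(2,\mathbb R)$ on $X$ and $Y$ are not topologically conjugate.
   Context: Work in the upper half-plane model of $\mathbb H^2$, with orientation-preserving isometry group $\mathrm{PSL}(2,\mathbb R)$ acting by Möbius maps. Let $n\ge3$, $m\ge2$ be integers, $\lambda=\lambda_n=2\cos(\pi/n)$, and let $G_n\subset\mathrm{PSL}(2,\mathbb R)$ be the Hecke group generated by $z\mapsto-1/z$ and $z\mapsto z+\lambda$. Let $\mathcal F_n$ be the packing by horoballs consisting of all images of $\{y\ge1\}$ under $G_n$; the closures of the components of the complement of its union are called $n$-gons (each bounded by arcs of $n$ cyclically tangent horoballs). The $(n,m)$ tile: start with the core $\gamma=\{x+iy:0\le x\le m\lambda,\ 1\le y\le m\}$. Attach below it $m$ prongs: the region bounded by the horocyclic segment from $i$ to $i+\lambda$ and the geodesic segments from $i$ and $i+\lambda$ to $e^{i\pi/n}$ (one $n$-th of an $n$-gon), and its translates by $\lambda,\dots,(m-1)\lambda$. Remove from the top a dent: the image of the first prong under $z\mapsto mz$. Add a small bump on the left vertical edge and remove the matching dent (its translate by $m\lambda$) on the right one, so that tiles meeting along vertical edges must be positioned like $\gamma$ and $\gamma+m\lambda$. $\mathcal T(n,m)$ is the space of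 all tilings of $\mathbb H^2$ by images of this tile under $\mathrm{PSL}(2,\mathbb R)$. A tiling is identified with the set of $g\in\mathrm{PSL}(2,\mathbb R)$ placing its tiles; the topology is that of convergence on compact sets (Fell topology on closed subsets of $\mathrm{PSL}(2,\mathbb R)$), which is compact metrizable, and $\mathrm{PSL}(2,\mathbb R)$ acts continuously. The tilings in $\mathcal T(n,m)$ are of two kinds (take this as the definition of $\mathcal T(n,m)$, each tiling being determined by its cores). Nondegenerate: the union of the cores is the union of a horoball packing $h(T)=g\mathcal F_n$, $g\in\mathrm{PSL}(2,\mathbb R)$, and each horoball is tiled by cores as follows (independently for different horoballs): after an isometry in $\mathrm{PSL}(2,\mathbb R)$ taking the horoball to $\{y\ge1\}$ and its tangency points with other horoballs to $i+l\lambda$, $l\in\mathbb Z$, the cores are the sets $\{\lambda(c_j+m^{j+1}l)\le x\le\lambda(c_j+m^{j+1}(l+1)),\ m^j\le y\le m^{j+1}\}$, $j\ge0$, $l\in\mathbb Z$, where $c_j\in\mathbb Z$ and $c_{j+1}\equiv c_j\pmod{m^{j+1}}$. Degenerate: the cores themselves tile $\mathbb H^2$; up to an isometry they are given by the same formula with $j$ ranging over all of $\mathbb Z$, $c_j\in\mathbb R$ and $c_{j+1}-c_j\in m^{j+1}\mathbb Z$. Actions of $G$ on $X$ and $Y$ are topologically conjugate if there is a homeomorphism $\alpha:X\to Y$ with $\alpha(g(x))=g(\alpha(x))$ for all $g\in G$, $x\in X$. *)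

theory Defs
  imports "HOL-Analysis.Analysis" "HOL-Algebra.Generated_Groups" "HOL-Number_Theory.Cong"
begin

definition mat22 :: "real \<Rightarrow> real \<Rightarrow> real \<Rightarrow> real \<Rightarrow> real^2^2" where
  "mat22 a b c d = vector [vector [a, b], vector [c, d]]"

lemma mat22_nth [simp]:
  "mat22 a b c d $ 1 $ 1 = a" "mat22 a b c d $ 1 $ 2 = b"
  "mat22 a b c d $ 2 $ 1 = c" "mat22 a b c d $ 2 $ 2 = d"
  by (simp_all add: mat22_def)

lemma mat22_eqI:
  fixes A B :: "real^2^2"
  assumes "A$1$1 = B$1$1" "A$1$2 = B$1$2" "A$2$1 = B$2$1" "A$2$2 = B$2$2"
  shows "A = B"
  using assms by (simp add: vec_eq_iff forall_2)

lemma matrix_mult_2_nth: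
  fixes A B :: "real^2^2"
  shows "(A ** B) $ i $ j = A$i$1 * B$1$j + A$i$2 * B$2$j"
  by (simp add: matrix_matrix_mult_def sum_2)

quotient_type psl2r = "real^2^2" / partial: "\<lambda>A B. det A = 1 \<and> (B = A \<or> B = - A)"
proof (rule part_equivpI)
  show "\<exists>A::real^2^2. det A = 1 \<and> (A = A \<or> A = - A)"
    by (rule exI[of _ "mat 1"]) (simp add: det_I)
  have *: "det (- A) = det A" for A :: "real^2^2"
    by (simp add: det_2)
  show "symp (\<lambda>A B::real^2^2. det A = 1 \<and> (B = A \<or> B = - A))"
    by (auto simp: symp_def *)
  show "transp (\<lambda>A B::real^2^2. det A = 1 \<and> (B = A \<or> B = - A))"
    by (auto simp: transp_def)
qed

instantiation psl2r :: monoid_mult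
begin

lift_definition one_psl2r :: psl2r is "mat 1"
  by (simp add: det_I)

lift_definition times_psl2r :: "psl2r \<Rightarrow> psl2r \<Rightarrow> psl2r" is "(**)"
  by (auto simp: det_mul matrix_mult_2_nth intro: mat22_eqI)

instance
proof
  fix a b c :: psl2r
  show "a * b * c = a * (b * c)"
    by transfer (auto simp: det_mul matrix_mul_assoc)
  show "1 * a = a" "a * 1 = a"
    by (transfer, auto)+
qed

end

text \<open>The quotient topology of $\mathrm{SL}(2,\mathbb R)\subseteq\mathbb R^{2\times2}$.\<close>

instantiation psl2r :: topological_space
begin

definition open_psl2r :: "psl2r set \<Rightarrow> bool" where
  "open_psl2r U \<longleftrightarrow>
     openin (top_of_set {A. det A = 1}) {A. det A = 1 \<and> abs_psl2r A \<in> U}"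

instance
proof
  show "open (UNIV :: psl2r set)"
    using openin_topspace[of "top_of_set {A::real^2^2. det A = 1}"]
    by (simp add: open_psl2r_def)
next
  fix S T :: "psl2r set"
  assume "open S" "open T"
  then have "openin (top_of_set {A. det A = 1})
    ({A. det A = 1 \<and> abs_psl2r A \<in> S} \<inter> {A. det A = 1 \<and> abs_psl2r A \<in> T})"
    unfolding open_psl2r_def by (rule openin_Int)
  moreover have "{A. det A = 1 \<and> abs_psl2r A \<in> S} \<inter> {A. det A = 1 \<and> abs_psl2r A \<in> T}
      = {A. det A = 1 \<and> abs_psl2r A \<in> S \<inter> T}"
    by auto
  ultimately show "open (S \<inter> T)"
    by (simp add: open_psl2r_def)
next
  fix K :: "psl2r set set"
  assume "\<forall>S\<in>K. open S"
  then have "openin (top_of_set {A. det A = 1})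
      (\<Union>S\<in>K. {A. det A = 1 \<and> abs_psl2r A \<in> S})"
    unfolding open_psl2r_def by (intro openin_Union) auto
  moreover have "(\<Union>S\<in>K. {A. det A = 1 \<and> abs_psl2r A \<in> S})
      = {A. det A = 1 \<and> abs_psl2r A \<in> \<Union>K}"
    by auto
  ultimately show "open (\<Union>K)"
    by (simp add: open_psl2r_def)
qed

end

definition PSL2R :: "psl2r monoid" where
  "PSL2R = \<lparr>carrier = UNIV, mult = (*), one = 1\<rparr>"

lemma psl2r_left_inverse: "\<exists>h. h * g = (1 :: psl2r)"
proof transfer
  fix A :: "real^2^2"
  assume "det A = 1 \<and> (A = A \<or> A = - A)"
  then have A: "A$1$1 * A$2$2 - A$1$2 * A$2$1 = 1"
    by (simp add: det_2)
  define B where "B = mat22 (A$2$2) (- A$1$2) (- A$2$1) (A$1$1)"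
  have "det B = 1"
    using A by (simp add: B_def det_2 algebra_simps)
  moreover have "B ** A = mat 1"
    using A by (intro mat22_eqI) (simp_all add: B_def matrix_mult_2_nth mat_def algebra_simps)
  ultimately show "\<exists>B\<in>{A. det A = 1 \<and> (A = A \<or> A = - A)}.
      det (B ** A) = 1 \<and> (mat 1 = B ** A \<or> mat 1 = - (B ** A))"
    by (intro bexI[of _ B]) (auto simp: det_I)
qed

lemma group_PSL2R: "group PSL2R"
proof (rule groupI)
  fix g assume "g \<in> carrier PSL2R"
  show "\<exists>h\<in>carrier PSL2R. h \<otimes>\<^bsub>PSL2R\<^esub> g = \<one>\<^bsub>PSL2R\<^esub>"
    using psl2r_left_inverse[of g] by (simp add: PSL2R_def)
qed (simp_all add: PSL2R_def mult.assoc)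

text \<open>The Moebius action; it is only ever used on points of the upper half-plane.\<close>

lift_definition moebius :: "psl2r \<Rightarrow> complex \<Rightarrow> complex" is
  "\<lambda>A z. (of_real (A$1$1) * z + of_real (A$1$2)) / (of_real (A$2$1) * z + of_real (A$2$2))"
proof -
  fix A B :: "real^2^2"
  assume "det A = 1 \<and> (B = A \<or> B = - A)"
  moreover have "(- p * z + - q) / (- r * z + - s) = (p * z + q) / (r * z + s)"
    for p q r s z :: complex
    using minus_divide_divide[of "p * z + q" "r * z + s"] by (simp add: algebra_simps)
  ultimately show "(\<lambda>z. (of_real (A$1$1) * z + of_real (A$1$2)) /
        (of_real (A$2$1) * z + of_real (A$2$2)) :: complex) =
      (\<lambda>z. (of_real (B$1$1) * z + of_real (B$1$2)) / (of_real (B$2$1) * z + of_real (B$2$2)))"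
    by auto
qed

definition hecke_lambda :: "nat \<Rightarrow> real" where
  "hecke_lambda n = 2 * cos (pi / real n)"

definition hecke_group :: "nat \<Rightarrow> psl2r set" where
  "hecke_group n =
     generate PSL2R {abs_psl2r (mat22 0 (- 1) 1 0), abs_psl2r (mat22 1 (hecke_lambda n) 0 1)}"

definition std_horoball :: "complex set" where
  "std_horoball = {z. 1 \<le> Im z}"

definition hecke_packing :: "nat \<Rightarrow> complex set set" where
  "hecke_packing n = {moebius g ` std_horoball | g. g \<in> hecke_group n}"

text \<open>Distinct horoballs of a packing have disjoint interiors, so they can meet only at a
  point of tangency.\<close>

definition tangency_points :: "complex set set \<Rightarrow> complex set \<Rightarrow> complex set" where
  "tangency_points P B = {z. \<exists>B'\<in>P. B' \<noteq> B \<and> z \<in> B \<inter> B'}"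

definition core :: "nat \<Rightarrow> nat \<Rightarrow> complex set" where
  "core n m = {z. 0 \<le> Re z \<and> Re z \<le> real m * hecke_lambda n \<and> 1 \<le> Im z \<and> Im z \<le> real m}"

definition level_core :: "nat \<Rightarrow> nat \<Rightarrow> int \<Rightarrow> real \<Rightarrow> int \<Rightarrow> complex set" where
  "level_core n m j c l =
     {z. hecke_lambda n * (c + real m powi (j + 1) * of_int l) \<le> Re z \<and>
         Re z \<le> hecke_lambda n * (c + real m powi (j + 1) * of_int (l + 1)) \<and>
         real m powi j \<le> Im z \<and> Im z \<le> real m powi (j + 1)}"

text \<open>The isometry \<open>g\<close> is the inverse of the one normalising \<open>B\<close>: it takes the standard
  horoball, with the points \<open>\<i> + l * hecke_lambda n\<close>, to \<open>B\<close> with its tangency points.\<close>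

definition horoball_tiling ::
    "nat \<Rightarrow> nat \<Rightarrow> complex set set \<Rightarrow> complex set \<Rightarrow> complex set set \<Rightarrow> bool" where
  "horoball_tiling n m P B D \<longleftrightarrow>
     (\<exists>g (c :: nat \<Rightarrow> int).
        moebius g ` std_horoball = B \<and>
        moebius g ` {\<i> + of_real (of_int l * hecke_lambda n) | l :: int. True} =
          tangency_points P B \<and>
        (\<forall>j. [c (j + 1) = c j] (mod (int m ^ (j + 1)))) \<and>
        D = {moebius g ` level_core n m (int j) (of_int (c j)) l | (j :: nat) (l :: int). True})"

definition nondegenerate_cores :: "nat \<Rightarrow> nat \<Rightarrow> complex set set \<Rightarrow> bool" where
  "nondegenerate_cores n m C \<longleftrightarrow>
     (\<exists>g P D. P = {moebius g ` B | B. B \<in> hecke_packing n} \<and>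
        (\<forall>B\<in>P. horoball_tiling n m P B (D B)) \<and>
        C = (\<Union>B\<in>P. D B))"

definition degenerate_cores :: "nat \<Rightarrow> nat \<Rightarrow> complex set set \<Rightarrow> bool" where
  "degenerate_cores n m C \<longleftrightarrow>
     (\<exists>g (c :: int \<Rightarrow> real).
        (\<forall>j. \<exists>k :: int. c (j + 1) - c j = real m powi (j + 1) * of_int k) \<and>
        C = {moebius g ` level_core n m j (c j) l | j l. True})"

text \<open>A tiling is identified with the set of all \<open>g\<close> that place one of its tiles. As the core
  has no nontrivial orientation-preserving symmetry, \<open>g\<close> can be read off from the core it
  places.\<close>

definition placements :: "nat \<Rightarrow> nat \<Rightarrow> complex set set \<Rightarrow> psl2r set" where
  "placements n m C = {g. moebius g ` core n m \<in> C}"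

definition tilings :: "nat \<Rightarrow> nat \<Rightarrow> psl2r set set" where
  "tilings n m = {placements n m C | C. nondegenerate_cores n m C \<or> degenerate_cores n m C}"

definition fell_topology :: "'a::topological_space set topology" where
  "fell_topology = topology_generated_by
     ({{F. closed F \<and> F \<inter> K = {}} | K. compact K} \<union>
      {{F. closed F \<and> F \<inter> U \<noteq> {}} | U. open U})"

lemma topspace_fell_topology: "topspace fell_topology = {F :: 'a::topological_space set. closed F}"
proof -
  have "{F :: 'a set. closed F} = {F. closed F \<and> F \<inter> {} = {}}"
    by simp
  then have "{F :: 'a set. closed F} \<in> {{F. closed F \<and> F \<inter> K = {}} | K. compact K}"
    using compact_empty by blast
  then show ?thesis
    unfolding fell_topology_def topology_generated_by_topspace by blast
qed

definition tiling_space :: "nat \<Rightarrow> nat \<Rightarrow> psl2r set topology" where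
  "tiling_space n m = subtopology fell_topology (tilings n m)"

definition translate :: "psl2r \<Rightarrow> psl2r set \<Rightarrow> psl2r set" where
  "translate g T = (\<lambda>h. g * h) ` T"

definition invariant :: "('g \<Rightarrow> 'x \<Rightarrow> 'x) \<Rightarrow> 'x set \<Rightarrow> bool" where
  "invariant act X \<longleftrightarrow> (\<forall>g. \<forall>x\<in>X. act g x \<in> X)"

definition topologically_conjugate ::
    "('g \<Rightarrow> 'x \<Rightarrow> 'x) \<Rightarrow> 'x topology \<Rightarrow> ('g \<Rightarrow> 'y \<Rightarrow> 'y) \<Rightarrow> 'y topology \<Rightarrow> bool" where
  "topologically_conjugate act1 X act2 Y \<longleftrightarrow>
     (\<exists>\<alpha>. homeomorphic_map X Y \<alpha> \<and> (\<forall>g. \<forall>x\<in>topspace X. \<alpha> (act1 g x) = act2 g (\<alpha> x)))"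

end

theory Submission
  imports Defs
begin

text \<open>The scaling factor \<open>m\<close> can be read off from stabilisers. The standard degenerate tiling, all of
whose \<open>c\<^sub>j\<close> vanish, is mapped to itself by \<open>z \<mapsto> m * z\<close>, a hyperbolic element of translation
length \<open>ln m\<close>. Nondegenerate tilings may well be fixed by hyperbolic elements of other lengths, so
one has to restrict to a part of the space on which only multiples of \<open>ln m\<close> can occur, and to
describe that part in terms that a conjugacy respects: as a closed invariant set.

Two facts achieve this. First, every nonempty closed invariant set of tilings contains the
standard one (\<open>standard_tiling_in_closed_invariant\<close>): deep inside any horoball a tiling is a tiling
of a half-plane, the congruences between the \<open>c\<^sub>j\<close> say that after a translation arbitrarily many
consecutive levels agree with the standard tiling, and shrinking by a power of \<open>m\<close> moves these
levels so that they cover any given compact region. Second, any two placements \<open>g\<close>, \<open>h\<close> of tiles in a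
degenerate tiling satisfy \<open>h = g * k\<close> with \<open>k\<close> of the form \<open>z \<mapsto> m powi i * z + b\<close>, whose
absolute trace is \<open>2 * cosh (i * ln m / 2)\<close>. These values form a closed set, so the condition that all
relative traces have this form is closed, and it is invariant because the relative trace
\<open>rel_trace g h\<close> does not change under left multiplication (\<open>closedin_traces_in_spectrum\<close>,
\<open>traces_in_spectrum_translate\<close>). If \<open>a\<close> fixes such a tiling and \<open>g\<close> is a placement in it,
then so is \<open>a * g\<close>, and the relative trace of the two is the absolute trace of \<open>a\<close>.

Now let a conjugacy take \<open>X\<close> to \<open>Y\<close>. The tilings in \<open>X\<close> that satisfy the trace condition for
\<open>m\<close> form a closed invariant set, nonempty since it contains the standard tiling for \<open>m\<close>. Its image is closed
and invariant in \<open>Y\<close>, hence contains the standard tiling for \<open>m'\<close>. The preimage of the latter is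
fixed by \<open>z \<mapsto> m' * z\<close>, so \<open>ln m'\<close> is a positive integer multiple of \<open>ln m\<close> and \<open>m \<le> m'\<close>. By
symmetry \<open>m = m'\<close>.\<close>

section \<open>Moebius maps in matrix coordinates\<close>

lemma det_mat22 [simp]: "det (mat22 p q r s) = p * s - q * r"
  by (simp add: det_2)

lemma psl2r_cases:
  obtains p q r s where "g = abs_psl2r (mat22 p q r s)" "p * s - q * r = 1"
proof -
  obtain A where A: "det A = 1" "g = abs_psl2r A"
    by (induct g rule: psl2r.abs_induct) auto
  have "A = mat22 (A$1$1) (A$1$2) (A$2$1) (A$2$2)" by (rule mat22_eqI) simp_all
  with A show thesis by (metis that det_2)
qed

lemma abs_psl2r_eq_iff:
  assumes "det A = 1" "det B = 1"
  shows "abs_psl2r A = abs_psl2r B \<longleftrightarrow> B = A \<or> B = - A"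
  using Quotient_rel[OF Quotient_psl2r, of A B] assms by simp

lemma abs_mat22_mult:
  assumes "p * s - q * r = 1" "p' * s' - q' * r' = 1"
  shows "abs_psl2r (mat22 p q r s) * abs_psl2r (mat22 p' q' r' s') =
    abs_psl2r (mat22 (p * p' + q * r') (p * q' + q * s') (r * p' + s * r') (r * q' + s * s'))"
proof -
  have "mat22 p q r s ** mat22 p' q' r' s' =
    mat22 (p * p' + q * r') (p * q' + q * s') (r * p' + s * r') (r * q' + s * s')"
    by (rule mat22_eqI) (simp_all add: matrix_mult_2_nth)
  then show ?thesis
    using assms by (simp add: times_psl2r.abs_eq eq_onp_def)
qed

lemma one_psl2r_mat22: "1 = abs_psl2r (mat22 1 0 0 1)"
  unfolding one_psl2r_def by (rule arg_cong[where f = abs_psl2r], rule mat22_eqI) (simp_all add: mat_def)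

lemma moebius_mat22:
  assumes "p * s - q * r = 1"
  shows "moebius (abs_psl2r (mat22 p q r s)) z =
    (of_real p * z + of_real q) / (of_real r * z + of_real s)"
  using assms by (simp add: moebius.abs_eq eq_onp_def)

lemma psl2r_inverse:
  fixes g :: psl2r
  obtains h where "h * g = 1" "g * h = 1"
  by (metis psl2r_left_inverse mult.assoc mult_1_left mult_1_right)

lemma moebius_denominator_nonzero:
  assumes "p * s - q * r = (1::real)" "Im z > 0"
  shows "of_real r * z + of_real s \<noteq> (0::complex)"
proof
  assume 0: "of_real r * z + of_real s = (0::complex)"
  then have "r * Im z = 0" by (auto simp: complex_eq_iff)
  with assms have "r = 0" by simp
  with 0 assms show False by simp
qed

lemma Im_moebius_mat22:
  assumes "p * s - q * r = 1"
  shows "Im (moebius (abs_psl2r (mat22 p q r s)) z) =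
    Im z / ((r * Re z + s)\<^sup>2 + (r * Im z)\<^sup>2)"
proof -
  have "p * Im z * (r * Re z + s) - (p * Re z + q) * (r * Im z) = Im z * (p * s - q * r)"
    by (simp add: algebra_simps)
  then show ?thesis
    using assms by (simp add: moebius_mat22 Im_divide)
qed

lemma Im_moebius_pos:
  assumes "Im z > 0"
  shows "Im (moebius g z) > 0"
proof (cases g rule: psl2r_cases)
  case (1 p q r s)
  have "(r * Re z + s)\<^sup>2 + (r * Im z)\<^sup>2 > 0"
    using moebius_denominator_nonzero[OF 1(2) assms]
    by (auto simp: complex_eq_iff sum_power2_gt_zero_iff)
  then show ?thesis
    using 1 assms by (simp add: Im_moebius_mat22)
qed

lemma moebius_1 [simp]: "moebius 1 z = z"
  by (simp add: one_psl2r_mat22 moebius_mat22)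

lemma moebius_mult:
  assumes "Im z > 0"
  shows "moebius (g * h) z = moebius g (moebius h z)"
proof (cases g rule: psl2r_cases)
  case g: (1 p q r s)
  show ?thesis
  proof (cases h rule: psl2r_cases)
    case h: (1 p' q' r' s')
    let ?c = "of_real :: real \<Rightarrow> complex"
    have d: "(p * p' + q * r') * (r * q' + s * s') - (p * q' + q * s') * (r * p' + s * r') = 1"
    proof -
      have "(p * p' + q * r') * (r * q' + s * s') - (p * q' + q * s') * (r * p' + s * r')
          = (p * s - q * r) * (p' * s' - q' * r')" by algebra
      with g h show ?thesis by simp
    qed
    define u where "u = ?c p' * z + ?c q'"
    define v where "v = ?c r' * z + ?c s'"
    have n: "v \<noteq> 0"
      using moebius_denominator_nonzero[OF h(2) assms] by (simp add: v_def)
    have "moebius g (moebius h z) = (?c p * (u / v) + ?c q) / (?c r * (u / v) + ?c s)"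
      unfolding g h moebius_mat22[OF g(2)] moebius_mat22[OF h(2)] u_def v_def by (rule refl)
    also have "\<dots> = ((?c p * u + ?c q * v) / v) / ((?c r * u + ?c s * v) / v)"
      using n by (simp add: add_divide_distrib)
    also have "\<dots> = (?c p * u + ?c q * v) / (?c r * u + ?c s * v)"
      using n by simp
    also have "\<dots> = moebius (g * h) z"
      unfolding g h abs_mat22_mult[OF g(2) h(2)] moebius_mat22[OF d] u_def v_def
      by (simp add: algebra_simps)
    finally show ?thesis by (rule sym)
  qed
qed

lemma moebius_image_mult:
  assumes "S \<subseteq> {z. Im z > 0}"
  shows "moebius (g * h) ` S = moebius g ` moebius h ` S"
  using assms by (force simp: moebius_mult image_iff)

lemma moebius_image_upper:
  assumes "S \<subseteq> {z. Im z > 0}"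
  shows "moebius g ` S \<subseteq> {z. Im z > 0}"
  using assms Im_moebius_pos by auto

lemma moebius_image_eq_iff:
  assumes "S \<subseteq> {z. Im z > 0}" "T \<subseteq> {z. Im z > 0}"
  shows "moebius g ` S = moebius g ` T \<longleftrightarrow> S = T"
proof
  assume eq: "moebius g ` S = moebius g ` T"
  obtain h where "h * g = 1" using psl2r_inverse by blast
  then show "S = T"
    using arg_cong[OF eq, of "\<lambda>U. moebius h ` U"]
    by (simp flip: moebius_image_mult[OF assms(1)] moebius_image_mult[OF assms(2)])
qed simp

lemma moebius_inj:
  assumes "moebius g z = moebius g w" "Im z > 0" "Im w > 0"
  shows "z = w"
  using moebius_image_eq_iff[of "{z}" "{w}" g] assms by simp

text \<open>For points of the upper half-plane the quotient is \<open>2 * cosh d - 2\<close>, where \<open>d\<close> is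
their hyperbolic distance.\<close>

lemma moebius_dist_invariant:
  assumes "Im z > 0" "Im w > 0"
  shows "(cmod (moebius g z - moebius g w))\<^sup>2 / (Im (moebius g z) * Im (moebius g w)) =
    (cmod (z - w))\<^sup>2 / (Im z * Im w)"
proof (cases g rule: psl2r_cases)
  case (1 p q r s)
  define u where "u = of_real r * z + of_real s"
  define v where "v = of_real r * w + of_real s"
  have n: "u \<noteq> 0" "v \<noteq> 0"
    using moebius_denominator_nonzero[OF 1(2)] assms by (auto simp: u_def v_def)
  have "(of_real p * z + of_real q) * v - (of_real p * w + of_real q) * u
      = of_real (p * s - q * r) * (z - w)"
    by (simp add: u_def v_def algebra_simps)
  then have "moebius g z - moebius g w = (z - w) / (u * v)"
    using n 1 by (simp add: moebius_mat22 diff_frac_eq flip: u_def v_def)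
  moreover have "Im (moebius g z) = Im z / (cmod u)\<^sup>2" "Im (moebius g w) = Im w / (cmod v)\<^sup>2"
    using 1 by (simp_all add: Im_moebius_mat22 cmod_power2 u_def v_def)
  ultimately show ?thesis
    using n by (simp add: norm_divide norm_mult power_divide power_mult_distrib)
qed

section \<open>The relative trace\<close>

text \<open>The absolute value of the trace of \<open>g\<^sup>-\<^sup>1 * h\<close>, with the inverse of a matrix of determinant one
written as its adjugate. The sign is lost in passing to the quotient.\<close>

lift_definition rel_trace :: "psl2r \<Rightarrow> psl2r \<Rightarrow> real" is
  "\<lambda>A B. \<bar>A$2$2 * B$1$1 - A$1$2 * B$2$1 - A$2$1 * B$1$2 + A$1$1 * B$2$2\<bar>"
  by (auto simp: algebra_simps)

lemma rel_trace_mat22: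
  assumes "p * s - q * r = 1" "p' * s' - q' * r' = 1"
  shows "rel_trace (abs_psl2r (mat22 p q r s)) (abs_psl2r (mat22 p' q' r' s')) =
    \<bar>s * p' - q * r' - r * q' + p * s'\<bar>"
  using assms by (simp add: rel_trace.abs_eq eq_onp_def)

lemma rel_trace_mult_left: "rel_trace (k * g) (k * h) = rel_trace g h"
proof (cases g rule: psl2r_cases)
  case g: (1 p q r s)
  show ?thesis
  proof (cases h rule: psl2r_cases)
    case h: (1 p' q' r' s')
    show ?thesis
    proof (cases k rule: psl2r_cases)
      case k: (1 a b c d)
      have det: "(a * p + b * r) * (c * q + d * s) - (a * q + b * s) * (c * p + d * r) = 1"
        if "p * s - q * r = 1" for p q r s
      proof -
        have "(a * p + b * r) * (c * q + d * s) - (a * q + b * s) * (c * p + d * r) =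
          (a * d - b * c) * (p * s - q * r)" by algebra
        with that k show ?thesis by simp
      qed
      have "(c * q + d * s) * (a * p' + b * r') - (a * q + b * s) * (c * p' + d * r')
          - (c * p + d * r) * (a * q' + b * s') + (a * p + b * r) * (c * q' + d * s')
        = (a * d - b * c) * (s * p' - q * r' - r * q' + p * s')" by algebra
      then show ?thesis
        unfolding g(1) h(1) k(1) abs_mat22_mult[OF k(2) g(2)] abs_mat22_mult[OF k(2) h(2)]
          rel_trace_mat22[OF det[OF g(2)] det[OF h(2)]] rel_trace_mat22[OF g(2) h(2)]
        using k(2) by simp
    qed
  qed
qed

text \<open>Up to sign this is \<open>tr (g\<^sup>-\<^sup>1 * a * g) = tr a\<close>: the relative trace of a placement and its image under a symmetry
depends on the symmetry only.\<close>

lemma rel_trace_conj: "rel_trace g (a * g) = rel_trace 1 a"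
proof (cases g rule: psl2r_cases)
  case g: (1 p q r s)
  show ?thesis
  proof (cases a rule: psl2r_cases)
    case k: (1 a b c d)
    have "(a * p + b * r) * (c * q + d * s) - (a * q + b * s) * (c * p + d * r) =
          (a * d - b * c) * (p * s - q * r)" by algebra
    then have det: "(a * p + b * r) * (c * q + d * s) - (a * q + b * s) * (c * p + d * r) = 1"
      using g k by simp
    have one: "1 * 1 - 0 * 0 = (1::real)" by simp
    have "s * (a * p + b * r) - q * (c * p + d * r)
          - r * (a * q + b * s) + p * (c * q + d * s)
        = (a + d) * (p * s - q * r)" by algebra
    then show ?thesis
      unfolding one_psl2r_mat22 g(1) k(1) abs_mat22_mult[OF k(2) g(2)]
        rel_trace_mat22[OF g(2) det] rel_trace_mat22[OF one k(2)]
      using g(2) by simp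
  qed
qed

section \<open>The topologies\<close>

text \<open>The saturation of an open set \<open>U\<close> of matrices is \<open>U \<union> - U\<close>, since the quotient only identifies a
matrix with its negative.\<close>

lemma open_abs_image:
  assumes "openin (top_of_set {A. det A = 1}) U"
  shows "open (abs_psl2r ` U)"
proof -
  have U: "U \<subseteq> {A. det A = 1}" using openin_imp_subset[OF assms] .
  have d: "det (- A) = det A" for A :: "real^2^2" by (simp add: det_2)
  have "{A. det A = 1 \<and> abs_psl2r A \<in> abs_psl2r ` U} = U \<union> ({A. det A = 1} \<inter> uminus -` U)"
  proof (intro subset_antisym subsetI)
    fix A :: "real^2^2" assume "A \<in> {A. det A = 1 \<and> abs_psl2r A \<in> abs_psl2r ` U}"
    then obtain B where "det A = 1" "abs_psl2r A = abs_psl2r B" "B \<in> U" by auto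
    then show "A \<in> U \<union> ({A. det A = 1} \<inter> uminus -` U)"
      using U by (auto simp: abs_psl2r_eq_iff)
  next
    fix A assume "A \<in> U \<union> ({A. det A = 1} \<inter> uminus -` U)"
    moreover have "abs_psl2r A = abs_psl2r (- A)" if "det A = 1"
      using that d by (simp add: abs_psl2r_eq_iff)
    ultimately show "A \<in> {A. det A = 1 \<and> abs_psl2r A \<in> abs_psl2r ` U}"
      using U by (metis (mono_tags, lifting) IntE UnE image_eqI mem_Collect_eq subsetD vimage_eq)
  qed
  moreover have "openin (top_of_set {A. det A = 1}) ({A::real^2^2. det A = 1} \<inter> uminus -` U)"
    using assms by (intro continuous_openin_preimage[where T = "{A. det A = 1}"])
      (auto intro!: continuous_intros simp: d)
  ultimately show ?thesis
    using assms by (simp add: open_psl2r_def openin_Un)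
qed

lemma closed_psl2r_iff:
  "closed S \<longleftrightarrow> closed {A. det A = 1 \<and> abs_psl2r A \<in> S}"
proof -
  have cd: "closed {A::real^2^2. det A = 1}"
    unfolding det_2 by (intro closed_Collect_eq continuous_intros)
  have "{A. det A = 1 \<and> abs_psl2r A \<in> - S} = {A. det A = 1} - {A. det A = 1 \<and> abs_psl2r A \<in> S}"
    by auto
  then have "closed S \<longleftrightarrow> closedin (top_of_set {A. det A = 1}) {A. det A = 1 \<and> abs_psl2r A \<in> S}"
    unfolding closed_def open_psl2r_def by (simp add: closedin_def Collect_mono_iff)
  also have "\<dots> \<longleftrightarrow> closed {A. det A = 1 \<and> abs_psl2r A \<in> S}"
    using closedin_closed_eq[OF cd, of "{A. det A = 1 \<and> abs_psl2r A \<in> S}"] by blast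
  finally show ?thesis .
qed

lemma continuous_on_psl2rI:
  fixes f :: "psl2r \<Rightarrow> 'a::topological_space"
  assumes "continuous_on {A. det A = 1} (\<lambda>A. f (abs_psl2r A))"
  shows "continuous_on UNIV f"
proof (rule continuous_on_open_vimage[THEN iffD2, OF open_UNIV], intro allI impI)
  fix B :: "'a set" assume "open B"
  then have "openin (top_of_set {A. det A = 1}) ({A. det A = 1} \<inter> (\<lambda>A. f (abs_psl2r A)) -` B)"
    using assms continuous_openin_preimage_gen by blast
  moreover have "{A. det A = 1} \<inter> (\<lambda>A. f (abs_psl2r A)) -` B =
      {A. det A = 1 \<and> abs_psl2r A \<in> f -` B \<inter> UNIV}" by auto
  ultimately show "open (f -` B \<inter> UNIV)"
    by (simp add: open_psl2r_def)
qed

text \<open>A subbasic condition of missing a compact set \<open>K\<close> depends on the intersection with \<open>K\<close> only, and for meeting an open set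
it suffices to keep a single point. Hence closed sets that agree with \<open>T\<close> on large compact sets
converge to \<open>T\<close>.\<close>

lemma fell_neighbourhood_compact:
  fixes T :: "'a::topological_space set"
  assumes "openin fell_topology W" "T \<in> W"
  shows "\<exists>K. compact K \<and> (\<forall>F. closed F \<and> F \<inter> K = T \<inter> K \<longrightarrow> F \<in> W)"
proof -
  let ?\<B> = "{{F :: 'a set. closed F \<and> F \<inter> K = {}} | K. compact K} \<union>
      {{F. closed F \<and> F \<inter> U \<noteq> {}} | U. open U}"
  have "generate_topology_on ?\<B> W"
    by (rule openin_topology_generated_by, fold fell_topology_def, rule assms(1))
  then show ?thesis
    using assms(2)
  proof induction
    case (Int A B)
    have "T \<in> A" "T \<in> B" using Int.prems by simp_all
    from Int.IH(1)[OF this(1)] obtain K where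
      K: "compact K" "\<forall>F. closed F \<and> F \<inter> K = T \<inter> K \<longrightarrow> F \<in> A" by (elim exE conjE)
    from Int.IH(2)[OF \<open>T \<in> B\<close>] obtain L where
      L: "compact L" "\<forall>F. closed F \<and> F \<inter> L = T \<inter> L \<longrightarrow> F \<in> B" by (elim exE conjE)
    have "F \<in> A \<inter> B" if "closed F" "F \<inter> (K \<union> L) = T \<inter> (K \<union> L)" for F
    proof -
      have "F \<inter> K = T \<inter> K" "F \<inter> L = T \<inter> L" using that(2) by blast+
      with that(1) K(2) L(2) show ?thesis by blast
    qed
    then show ?case
      using compact_Un[OF K(1) L(1)] by (intro exI[of _ "K \<union> L"]) simp
  next
    case (UN \<A>)
    then obtain A where A: "A \<in> \<A>" "T \<in> A" by (elim UnionE)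
    from UN.IH[OF this] obtain K where
      "compact K" "\<forall>F. closed F \<and> F \<inter> K = T \<inter> K \<longrightarrow> F \<in> A" by (elim exE conjE)
    with A(1) show ?case by (intro exI[of _ K]) auto
  next
    case (Basis A)
    from Basis(1) consider K where "compact K" "A = {F. closed F \<and> F \<inter> K = {}}"
      | U where "open U" "A = {F. closed F \<and> F \<inter> U \<noteq> {}}" by blast
    then show ?case
    proof cases
      case 1
      with Basis show ?thesis by auto
    next
      case 2
      with Basis obtain h where "h \<in> T \<inter> U" by blast
      with 2 show ?thesis
        by (intro exI[of _ "{h}"]) auto
    qed
  qed simp
qed

section \<open>Height of the image of the imaginary unit\<close>

text \<open>A proxy for how high a tile is placed: \<open>\<i>\<close> is a corner of the core.\<close>

definition height :: "psl2r \<Rightarrow> real" where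
  "height g = Im (moebius g \<i>)"

lemma height_pos: "height g > 0"
  by (simp add: height_def Im_moebius_pos)

lemma height_abs:
  assumes "det A = 1"
  shows "height (abs_psl2r A) = 1 / ((A$2$1)\<^sup>2 + (A$2$2)\<^sup>2)"
proof -
  have "A = mat22 (A$1$1) (A$1$2) (A$2$1) (A$2$2)" by (rule mat22_eqI) simp_all
  then show ?thesis
    using Im_moebius_mat22[of "A$1$1" "A$2$2" "A$1$2" "A$2$1" \<i>] assms
    by (simp add: height_def det_2 add.commute)
qed

lemma continuous_on_height: "continuous_on UNIV height"
proof (rule continuous_on_psl2rI)
  have "(A$2$1)\<^sup>2 + (A$2$2)\<^sup>2 \<noteq> 0" if "det A = 1" for A :: "real^2^2"
    using that by (auto simp: det_2 sum_power2_eq_zero_iff)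
  then have "continuous_on {A. det A = 1} (\<lambda>A::real^2^2. 1 / ((A$2$1)\<^sup>2 + (A$2$2)\<^sup>2))"
    by (intro continuous_intros) auto
  then show "continuous_on {A. det A = 1} (\<lambda>A. height (abs_psl2r A))"
    by (rule continuous_on_eq) (simp add: height_abs)
qed

lemma compact_height_bounds:
  assumes "compact K" "1 < b"
  obtains M :: nat where "\<And>h. h \<in> K \<Longrightarrow> b powi (- int M) < height h \<and> height h < b powi int M"
proof -
  have "compact ((\<lambda>h. ln (height h)) ` K)"
    using continuous_on_height height_pos
    by (intro compact_continuous_image assms continuous_intros)
      (auto intro: continuous_on_subset simp: less_imp_neq[THEN not_sym])
  then obtain R where R: "\<And>h. h \<in> K \<Longrightarrow> \<bar>ln (height h)\<bar> \<le> R"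
    using compact_imp_bounded bounded_real by (metis (no_types, lifting) image_eqI)
  obtain M :: nat where M: "R < real M * ln b"
    using ex_less_of_nat_mult[of "ln b" R] assms by auto
  show thesis
  proof
    fix h assume "h \<in> K"
    from R[OF this] M have *: "\<bar>ln (height h)\<bar> < real M * ln b" by simp
    have e: "b powi int M = exp (real M * ln b)"
      using assms by (simp add: exp_of_nat_mult)
    have h: "height h = exp (ln (height h))" using height_pos by simp
    have "exp (- (real M * ln b)) < exp (ln (height h))"
      unfolding exp_less_cancel_iff using * by linarith
    moreover have "exp (ln (height h)) < exp (real M * ln b)"
      unfolding exp_less_cancel_iff using * by linarith
    ultimately show "b powi (- int M) < height h \<and> height h < b powi int M"
      unfolding power_int_minus e exp_minus[symmetric] h[symmetric] by blast
  qed
qed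

section \<open>Rigidity of rectangles\<close>

text \<open>In a rectangle of width \<open>a\<close> standing on the line of height \<open>1\<close>, the two lower corners are the unique
pair of points at maximal hyperbolic distance. Indeed, if \<open>y'\<close> is the smaller height then
\<open>(y - y')\<^sup>2 \<le> (y - 1) * (b - 1)\<close>, which is less than \<open>a\<^sup>2 * (y - 1) \<le> a\<^sup>2 * (y * y' - 1)\<close>
unless \<open>y = 1\<close>.\<close>

lemma rectangle_farthest_pair:
  fixes a b x y x' y' :: real
  assumes "0 \<le> x" "x \<le> a" "0 \<le> x'" "x' \<le> a" "1 \<le> y" "y \<le> b" "1 \<le> y'" "y' \<le> b" "b - 1 < a\<^sup>2"
    and "(x - x')\<^sup>2 + (y - y')\<^sup>2 = a\<^sup>2 * (y * y')"
  shows "y = 1 \<and> y' = 1 \<and> (x = 0 \<and> x' = a \<or> x = a \<and> x' = 0)"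
proof -
  have main: "y = 1 \<and> y' = 1"
    if "y' \<le> y" "1 \<le> y'" "y \<le> b" "(x - x')\<^sup>2 + (y - y')\<^sup>2 = a\<^sup>2 * (y * y')" for y y'
  proof -
    have "\<bar>x - x'\<bar> \<le> \<bar>a\<bar>" using assms by auto
    then have 1: "(x - x')\<^sup>2 \<le> a\<^sup>2" by (simp add: abs_le_square_iff)
    have 2: "(y - y')\<^sup>2 \<le> (y - 1) * (b - 1)"
      unfolding power2_eq_square using that by (intro mult_mono) auto
    have "y * 1 \<le> y * y'" using that by (intro mult_left_mono) auto
    then have 3: "a\<^sup>2 * (y - 1) \<le> a\<^sup>2 * (y * y' - 1)"
      by (intro mult_left_mono) auto
    have "(y - 1) * a\<^sup>2 \<le> (y - 1) * (b - 1)"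
      using 1 2 3 that(4) by (simp add: algebra_simps)
    with assms(9) that have "y = 1"
      by (metis le_less_trans less_eq_real_def linorder_not_le mult_le_cancel_left_pos diff_gt_0_iff_gt order_trans)
    with that show ?thesis by simp
  qed
  have "y = 1 \<and> y' = 1"
  proof (cases "y' \<le> y")
    case True
    then show ?thesis using main assms by blast
  next
    case False
    then show ?thesis using main[of y y'] assms by (simp add: power2_commute mult.commute)
  qed
  moreover from this have "(x - x')\<^sup>2 = a\<^sup>2" using assms by simp
  then have "x - x' = a \<or> x - x' = - a" by (simp add: power2_eq_iff)
  ultimately show ?thesis using assms by auto
qed

text \<open>A symmetry preserves the farthest pair, the two lower corners. If it fixes both, it is the identity.
If it swaps them, it is the half-turn about a point of the vertical line through the middle of the rectangle, and the images of
the midpoint of the bottom edge and of an upper corner cannot both lie between the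
heights \<open>1\<close> and \<open>b\<close>.\<close>

lemma rectangle_rigid:
  fixes a b :: real
  assumes S: "S = {z. 0 \<le> Re z \<and> Re z \<le> a \<and> 1 \<le> Im z \<and> Im z \<le> b}"
    and ab: "0 < a" "1 < b" "b - 1 < a\<^sup>2" and g: "moebius g ` S = S"
  shows "g = 1"
proof -
  obtain p q r s where g': "g = abs_psl2r (mat22 p q r s)" and det: "p * s - q * r = 1"
    by (rule psl2r_cases)
  note nz = moebius_denominator_nonzero[OF det]
  have "\<i> \<in> S" "of_real a + \<i> \<in> S"
    using ab by (auto simp: S)
  then have gS: "moebius g \<i> \<in> S" "moebius g (of_real a + \<i>) \<in> S"
    using g by blast+
  let ?z = "moebius g \<i>" and ?w = "moebius g (of_real a + \<i>)"
  have "(cmod (?z - ?w))\<^sup>2 / (Im ?z * Im ?w) = a\<^sup>2"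
    using moebius_dist_invariant[of \<i> "of_real a + \<i>" g] by (simp add: cmod_power2)
  moreover have "Im ?z * Im ?w > 0" using Im_moebius_pos by simp
  ultimately have "(cmod (?z - ?w))\<^sup>2 = a\<^sup>2 * (Im ?z * Im ?w)"
    by (metis divide_eq_eq less_irrefl)
  then have far: "(Re ?z - Re ?w)\<^sup>2 + (Im ?z - Im ?w)\<^sup>2 = a\<^sup>2 * (Im ?z * Im ?w)"
    by (simp add: cmod_power2)
  have "Im ?z = 1 \<and> Im ?w = 1 \<and> (Re ?z = 0 \<and> Re ?w = a \<or> Re ?z = a \<and> Re ?w = 0)"
    by (rule rectangle_farthest_pair[OF _ _ _ _ _ _ _ _ ab(3) far]) (use gS in \<open>simp_all add: S\<close>)
  then consider "?z = \<i>" "?w = of_real a + \<i>" | "?z = of_real a + \<i>" "?w = \<i>"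
    by (metis complex_eqI Re_complex_of_real Im_complex_of_real add_0 add_0_right imaginary_unit.simps plus_complex.simps)
  then show ?thesis
  proof cases
    case 1
    note fix1 = \<open>?z = \<i>\<close> and fix2 = \<open>?w = of_real a + \<i>\<close>
    from fix1 have "of_real p * \<i> + of_real q = \<i> * (of_real r * \<i> + of_real s)"
      using nz[of \<i>] by (simp add: g' moebius_mat22[OF det] divide_eq_eq)
    then have 1: "p = s" "q = - r" by (auto simp: complex_eq_iff)
    from fix2 have "of_real p * (of_real a + \<i>) + of_real q =
        (of_real a + \<i>) * (of_real r * (of_real a + \<i>) + of_real s)"
      using nz[of "of_real a + \<i>"] by (simp add: g' moebius_mat22[OF det] divide_eq_eq)
    then have "p = 2 * a * r + s" by (auto simp: complex_eq_iff)
    with 1 ab have "r = 0" by simp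
    with 1 det have "q = 0" "s = p" "p * p = 1" by auto
    then have "mat22 p q r s = mat22 1 0 0 1 \<or> mat22 p q r s = - mat22 1 0 0 1"
      using \<open>r = 0\<close> by (auto simp: square_eq_1_iff intro!: mat22_eqI)
    then show "g = 1"
      unfolding g' one_psl2r_mat22 using det by (subst abs_psl2r_eq_iff) auto
  next
    case 2
    note sw1 = \<open>?z = of_real a + \<i>\<close> and sw2 = \<open>?w = \<i>\<close>
    from sw1 have "of_real p * \<i> + of_real q = (of_real a + \<i>) * (of_real r * \<i> + of_real s)"
      using nz[of \<i>] by (simp add: g' moebius_mat22[OF det] divide_eq_eq)
    then have 1: "q = a * s - r" "p = a * r + s" by (auto simp: complex_eq_iff)
    from sw2 have "of_real p * (of_real a + \<i>) + of_real q =
        \<i> * (of_real r * (of_real a + \<i>) + of_real s)"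
      using nz[of "of_real a + \<i>"] by (simp add: g' moebius_mat22[OF det] divide_eq_eq)
    then have 2: "p * a + q = - r" by (auto simp: complex_eq_iff)
    have "a * (s + p) = 0" using 1(1) 2 by (simp add: algebra_simps)
    with ab(1) have "s + p = 0" by simp
    then have s: "s = - (a * r / 2)" and p: "p = a * r / 2" using 1(2) by linarith+
    have q: "q = - (a * a * r / 2) - r" using 1(1) by (simp add: s)
    have d: "r\<^sup>2 * (1 + a\<^sup>2 / 4) = 1"
      using det unfolding p q s by (simp add: power2_eq_square field_simps)
    \<comment> \<open>The first image has height \<open>1 / r\<^sup>2\<close>, so \<open>1 / r\<^sup>2 \<le> b\<close>. That the second one has height
      at least \<open>1\<close> amounts to \<open>1 / r\<^sup>2 \<ge> b + 1\<close>.\<close>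
    have "of_real (a / 2) + \<i> \<in> S" "of_real a + \<i> * of_real b \<in> S"
      using ab by (auto simp: S)
    then have "moebius g (of_real (a / 2) + \<i>) \<in> S" "moebius g (of_real a + \<i> * of_real b) \<in> S"
      using g by blast+
    then have "Im (moebius g (of_real (a / 2) + \<i>)) \<le> b" "1 \<le> Im (moebius g (of_real a + \<i> * of_real b))"
      by (auto simp: S)
    moreover have "r * a / 2 + s = 0" "r * a + s = r * a / 2" by (simp_all add: s)
    ultimately have "1 / r\<^sup>2 \<le> b" "1 \<le> b / ((r * a / 2)\<^sup>2 + (r * b)\<^sup>2)"
      unfolding g' Im_moebius_mat22[OF det] by simp_all
    moreover have "r \<noteq> 0" using d by auto
    moreover have "(r * a / 2)\<^sup>2 + (r * b)\<^sup>2 > 0"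
      using \<open>r \<noteq> 0\<close> ab by (simp add: add_nonneg_pos)
    ultimately have 3: "1 \<le> b * r\<^sup>2" "(r * a / 2)\<^sup>2 + (r * b)\<^sup>2 \<le> b"
      by (simp_all add: field_simps)
    have "(r * a / 2)\<^sup>2 = 1 - r\<^sup>2" using d by (simp add: power2_eq_square field_simps)
    then have "1 - r\<^sup>2 + r\<^sup>2 * b\<^sup>2 \<le> b" using 3 by (simp add: power_mult_distrib)
    then have "(b - 1) * (r\<^sup>2 * (b + 1)) \<le> (b - 1) * 1"
      by (simp add: power2_eq_square algebra_simps)
    then have "r\<^sup>2 * (b + 1) \<le> 1" using ab by simp
    moreover have "r\<^sup>2 * (b + 1) = b * r\<^sup>2 + r\<^sup>2" by (simp add: algebra_simps)
    ultimately have "r\<^sup>2 \<le> 0" using 3(1) by linarith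
    with \<open>r \<noteq> 0\<close> show "g = 1" by simp
  qed
qed

section \<open>The maps \<open>z \<mapsto> exp t * z + b\<close>\<close>

text \<open>The isometry \<open>z \<mapsto> exp t * z + b\<close>. Parametrising the factor by its logarithm makes composition additive in \<open>t\<close> and
the relative trace a hyperbolic cosine.\<close>

definition scale_shift :: "real \<Rightarrow> real \<Rightarrow> psl2r" where
  "scale_shift t b = abs_psl2r (mat22 (exp (t / 2)) (b * exp (- t / 2)) 0 (exp (- t / 2)))"

lemma scale_shift_det: "exp (t / 2) * exp (- t / 2) - b * exp (- t / 2) * 0 = (1 :: real)"
  by (simp flip: exp_add)

lemma moebius_scale_shift: "moebius (scale_shift t b) z = of_real (exp t) * z + of_real b"
proof -
  have "moebius (scale_shift t b) z =
      of_real (exp (t / 2) / exp (- t / 2)) * z + of_real (b * exp (- t / 2) / exp (- t / 2))"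
    unfolding scale_shift_def moebius_mat22[OF scale_shift_det] by (simp add: add_divide_distrib)
  also have "exp (t / 2) / exp (- t / 2) = exp t"
    by (simp flip: exp_diff)
  finally show ?thesis by simp
qed

lemma scale_shift_mult: "scale_shift s b * scale_shift t c = scale_shift (s + t) (exp s * c + b)"
proof -
  have 1: "exp (s / 2) * exp (t / 2) + b * exp (- s / 2) * 0 = exp ((s + t) / 2)"
    by (simp add: add_divide_distrib flip: exp_add)
  have "exp s * exp (- (s + t) / 2) = exp (s / 2) * exp (- t / 2)"
    by (simp add: field_simps flip: exp_add)
  moreover have "exp (- (s + t) / 2) = exp (- s / 2) * exp (- t / 2)"
    by (simp add: field_simps flip: exp_add)
  ultimately have 2: "exp (s / 2) * (c * exp (- t / 2)) + b * exp (- s / 2) * exp (- t / 2) =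
      (exp s * c + b) * exp (- (s + t) / 2)"
    by (simp add: distrib_right mult.assoc mult.left_commute)
  have 3: "0 * (c * exp (- t / 2)) + exp (- s / 2) * exp (- t / 2) = exp (- (s + t) / 2)"
    by (simp add: field_simps flip: exp_add)
  show ?thesis
    unfolding scale_shift_def abs_mat22_mult[OF scale_shift_det scale_shift_det] 1 2 3 by simp
qed

lemma scale_shift_0_0: "scale_shift 0 0 = 1"
  by (simp add: scale_shift_def one_psl2r_mat22)

lemma rel_trace_scale_shift: "rel_trace (scale_shift s b) (scale_shift t c) = 2 * cosh ((t - s) / 2)"
proof -
  have "exp (- s / 2) * exp (t / 2) = exp ((t - s) / 2)"
    "exp (s / 2) * exp (- t / 2) = exp (- ((t - s) / 2))"
    by (simp_all add: field_simps flip: exp_add)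
  then have "rel_trace (scale_shift s b) (scale_shift t c) = \<bar>exp ((t - s) / 2) + exp (- ((t - s) / 2))\<bar>"
    unfolding scale_shift_def rel_trace_mat22[OF scale_shift_det scale_shift_det] by simp
  then show ?thesis by (simp add: cosh_def)
qed

lemma height_scale_shift_mult: "height (scale_shift t b * h) = exp t * height h"
  by (simp add: height_def moebius_mult moebius_scale_shift)

lemma powi_eq_exp:
  assumes "(b::real) > 0"
  shows "b powi j = exp (of_int j * ln b)"
  using assms by (simp add: powr_def flip: powr_real_of_int')

section \<open>Cores\<close>

lemma hecke_lambda_ge_1:
  assumes "n \<ge> 3"
  shows "hecke_lambda n \<ge> 1"
proof -
  have "pi / real n \<le> pi / 3"
    using assms by (intro divide_left_mono) auto
  then have "cos (pi / 3) \<le> cos (pi / real n)"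
    using assms by (intro cos_monotone_0_pi_le) auto
  then show ?thesis
    by (simp add: hecke_lambda_def cos_60)
qed

lemma core_eq_level_core: "core n m = level_core n m 0 0 0"
  by (simp add: core_def level_core_def mult.commute)

text \<open>Only the class of \<open>c\<close> modulo \<open>m powi (j + 1)\<close> matters for the set of cores of a level.\<close>

lemma level_core_shift:
  "level_core n m j (c + real m powi (j + 1) * of_int k) l = level_core n m j c (l + k)"
  by (simp add: level_core_def algebra_simps)

lemma scale_shift_image_box:
  assumes "e = exp t"
  shows "moebius (scale_shift t b) ` {z. x1 \<le> Re z \<and> Re z \<le> x2 \<and> y1 \<le> Im z \<and> Im z \<le> y2} =
    {z. e * x1 + b \<le> Re z \<and> Re z \<le> e * x2 + b \<and> e * y1 \<le> Im z \<and> Im z \<le> e * y2}"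
proof -
  have e: "e > 0" using assms by simp
  have "z \<in> moebius (scale_shift t b) ` {z. x1 \<le> Re z \<and> Re z \<le> x2 \<and> y1 \<le> Im z \<and> Im z \<le> y2}"
    if "e * x1 + b \<le> Re z" "Re z \<le> e * x2 + b" "e * y1 \<le> Im z" "Im z \<le> e * y2" for z
  proof (rule image_eqI)
    show "z = moebius (scale_shift t b) (Complex ((Re z - b) / e) (Im z / e))"
      using e by (simp add: moebius_scale_shift complex_eq_iff flip: assms)
  qed (use that e in \<open>simp add: field_simps\<close>)
  moreover have "moebius (scale_shift t b) z \<in> {z. e * x1 + b \<le> Re z \<and> Re z \<le> e * x2 + b \<and> e * y1 \<le> Im z \<and> Im z \<le> e * y2}"
    if "x1 \<le> Re z \<and> Re z \<le> x2 \<and> y1 \<le> Im z \<and> Im z \<le> y2" for z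
    using that e by (simp add: moebius_scale_shift flip: assms)
  ultimately show ?thesis by blast
qed

lemma scale_shift_image_level_core:
  assumes "m \<ge> 2"
  shows "moebius (scale_shift (of_int k * ln (real m)) (hecke_lambda n * b)) ` level_core n m j c l =
    level_core n m (k + j) (real m powi k * c + b) l"
proof -
  have m: "real m > 0" using assms by simp
  have p: "real m powi (k + j) = real m powi k * real m powi j"
      "real m powi (k + j + 1) = real m powi k * real m powi (j + 1)"
    using m by (simp_all add: power_int_add add.assoc)
  show ?thesis
    unfolding level_core_def scale_shift_image_box[OF powi_eq_exp[OF m]] p
    by (simp add: algebra_simps)
qed

definition core_placement :: "nat \<Rightarrow> nat \<Rightarrow> int \<Rightarrow> int \<Rightarrow> psl2r" where
  "core_placement n m j l =
    scale_shift (of_int j * ln (real m)) (hecke_lambda n * (real m powi (j + 1) * of_int l))"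

lemma core_placement_image:
  assumes "m \<ge> 2"
  shows "moebius (core_placement n m j l) ` core n m = level_core n m j 0 l"
proof -
  have "moebius (core_placement n m j l) ` core n m =
      level_core n m j (0 + real m powi (j + 1) * of_int l) 0"
    using scale_shift_image_level_core[OF assms, of j n "real m powi (j + 1) * of_int l" 0 0 0]
    by (simp add: core_placement_def core_eq_level_core)
  then show ?thesis
    unfolding level_core_shift by simp
qed

lemma level_core_upper:
  assumes "m \<ge> 2"
  shows "level_core n m j c l \<subseteq> {z. Im z > 0}"
proof -
  have "real m powi j > 0" using assms by simp
  then show ?thesis by (auto simp: level_core_def)
qed

lemma core_upper: "core n m \<subseteq> {z. Im z > 0}"
  by (auto simp: core_def)

lemma i_in_core: "m \<ge> 2 \<Longrightarrow> n \<ge> 3 \<Longrightarrow> \<i> \<in> core n m"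
  using hecke_lambda_ge_1[of n] by (simp add: core_def)

text \<open>The width of the core is \<open>m * hecke_lambda n \<ge> m\<close>, large enough for it to be rigid.\<close>

lemma core_rigid:
  assumes "n \<ge> 3" "m \<ge> 2" "moebius g ` core n m = moebius h ` core n m"
  shows "g = h"
proof -
  obtain k where k: "k * h = 1" "h * k = 1" using psl2r_inverse by blast
  have "moebius (k * g) ` core n m = core n m"
    using assms(3) k(1) by (simp add: moebius_image_mult[OF core_upper]
        flip: moebius_image_mult[OF core_upper, of k h])
  moreover have "real m - 1 < (real m * hecke_lambda n)\<^sup>2"
  proof -
    have "real m * 1 \<le> real m * hecke_lambda n"
      using hecke_lambda_ge_1[OF assms(1)] by (intro mult_left_mono) auto
    moreover have "1 \<le> real m" using assms by simp
    ultimately have "real m * 1 \<le> (real m * hecke_lambda n) * (real m * hecke_lambda n)"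
      by (intro mult_mono) linarith+
    then show ?thesis by (simp add: power2_eq_square)
  qed
  moreover have "0 < real m * hecke_lambda n"
    using hecke_lambda_ge_1[OF assms(1)] assms(2) by simp
  ultimately have "k * g = 1"
    using assms(2) by (intro rectangle_rigid[OF core_def[of n m]]) auto
  then have "h * (k * g) = h" by simp
  then show ?thesis using k(2) by (simp flip: mult.assoc)
qed

section \<open>The standard degenerate tiling\<close>

definition standard_tiling :: "nat \<Rightarrow> nat \<Rightarrow> psl2r set" where
  "standard_tiling n m = placements n m {level_core n m j 0 l | j l. True}"

lemma standard_tiling_eq:
  assumes "n \<ge> 3" "m \<ge> 2"
  shows "standard_tiling n m = {core_placement n m j l | j l. True}"
  using core_rigid[OF assms]
  by (auto simp: standard_tiling_def placements_def simp flip: core_placement_image[OF assms(2)]) 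

lemma standard_tiling_in_tilings: "standard_tiling n m \<in> tilings n m"
proof -
  have "degenerate_cores n m {level_core n m j 0 l | j l. True}"
    unfolding degenerate_cores_def
    by (rule exI[of _ 1], rule exI[of _ "\<lambda>_. 0"]) (auto intro: exI[of _ 0])
  then show ?thesis
    by (auto simp: tilings_def standard_tiling_def)
qed

lemma scaling_fixes_standard_tiling:
  assumes "n \<ge> 3" "m \<ge> 2"
  shows "translate (scale_shift (ln (real m)) 0) (standard_tiling n m) = standard_tiling n m"
proof -
  have *: "scale_shift (ln (real m)) 0 * core_placement n m j l = core_placement n m (j + 1) l" for j l
    using assms(2)
    by (simp add: core_placement_def scale_shift_mult power_int_add algebra_simps power2_eq_square)
  have "core_placement n m j l \<in> translate (scale_shift (ln (real m)) 0) (standard_tiling n m)" for j l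
    unfolding translate_def standard_tiling_eq[OF assms]
    using *[of "j - 1" l] by (intro image_eqI[of _ _ "core_placement n m (j - 1) l"]) auto
  then show ?thesis
    by (auto simp: translate_def standard_tiling_eq[OF assms] *) blast
qed

lemma core_placement_mat22:
  fixes j :: int
  assumes "m \<ge> 2"
  defines "E \<equiv> exp (of_int j * ln (real m) / 2)"
  shows "core_placement n m j l =
    abs_psl2r (mat22 E (hecke_lambda n * real m * of_int l * E) 0 (1 / E))"
proof -
  have "real m powi (j + 1) = real m * real m powi j"
    using assms(1) power_int_add[of "real m" j 1] by simp
  also have "real m powi j = E * E"
    using assms(1) by (simp add: powi_eq_exp E_def flip: exp_add)
  finally have "hecke_lambda n * (real m powi (j + 1) * of_int l) * (1 / E) =
      hecke_lambda n * real m * of_int l * E"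
    by (simp add: E_def)
  moreover have "exp (- (of_int j * ln (real m)) / 2) = 1 / E"
    by (simp add: E_def exp_minus inverse_eq_divide)
  ultimately show ?thesis
    unfolding core_placement_def scale_shift_def by (simp only: E_def)
qed

text \<open>The points of the Fell topology are closed sets, so closedness is what makes the standard tiling a
point of the tiling space. Its placements are the upper triangular matrices on which the level and
the number, continuous functions of the matrix entries, take integer values.\<close>

lemma closed_standard_tiling:
  assumes "n \<ge> 3" "m \<ge> 2"
  shows "closed (standard_tiling n m)"
proof -
  let ?L = "ln (real m)" and ?c = "hecke_lambda n * real m"
  have L: "?L > 0" and c: "?c \<noteq> 0"
    using assms hecke_lambda_ge_1[OF assms(1)] by auto
  define E where "E j = exp (of_int j * ?L / 2)" for j :: int
  define B where "B j l = mat22 (E j) (?c * of_int l * E j) 0 (1 / E j)" for j l :: int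
  have E: "E j > 0" for j by (simp add: E_def)
  have detB: "det (B j l) = 1" for j l using E[of j] by (simp add: B_def)
  have placement: "core_placement n m j l = abs_psl2r (B j l)" for j l
    unfolding B_def E_def by (rule core_placement_mat22[OF assms(2)])
  define D where "D = {A::real^2^2. det A = 1 \<and> A$2$1 = 0}"
  define Z where "Z = (D \<inter> (\<lambda>A. 2 * ln \<bar>A$1$1\<bar> / ?L) -` \<int>) \<inter> (D \<inter> (\<lambda>A. A$1$2 / (?c * A$1$1)) -` \<int>)"
  have D: "closed D"
    unfolding D_def det_2 Collect_conj_eq by (intro closed_Int closed_Collect_eq continuous_intros)
  have nz: "A$1$1 \<noteq> 0" if "A \<in> D" for A
    using that by (auto simp: D_def det_2)
  have "closed (D \<inter> (\<lambda>A. 2 * ln \<bar>A$1$1\<bar> / ?L) -` \<int>)" "closed (D \<inter> (\<lambda>A. A$1$2 / (?c * A$1$1)) -` \<int>)"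
    using nz L c by (intro continuous_closed_preimage D closed_Ints continuous_intros; auto)+
  then have "closed Z" unfolding Z_def by (rule closed_Int)
  also have "Z = {A. det A = 1 \<and> abs_psl2r A \<in> standard_tiling n m}"
  proof (intro subset_antisym subsetI)
    fix A assume "A \<in> Z"
    then obtain j l where A: "A \<in> D" "2 * ln \<bar>A$1$1\<bar> / ?L = of_int j" "A$1$2 / (?c * A$1$1) = of_int l"
      by (auto simp: Z_def elim!: Ints_cases)
    have "ln \<bar>A$1$1\<bar> = of_int j * ?L / 2" using A(2) L by (simp add: field_simps)
    then have 1: "\<bar>A$1$1\<bar> = E j" using nz[OF A(1)] unfolding E_def by (metis exp_ln zero_less_abs_iff)
    have 2: "A$1$2 = ?c * of_int l * A$1$1" using A(3) c nz[OF A(1)] by (simp add: field_simps)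
    have 3: "A$2$2 = 1 / A$1$1" using A(1) nz[OF A(1)] by (simp add: D_def det_2 field_simps)
    have 4: "A$2$1 = 0" "det A = 1" using A(1) by (auto simp: D_def)
    have "A = B j l \<or> A = - B j l"
    proof (cases "A$1$1 > 0")
      case True
      then have "A$1$1 = E j" using 1 by simp
      then show ?thesis using 2 3 4 by (intro disjI1 mat22_eqI) (simp_all add: B_def)
    next
      case False
      then have "A$1$1 = - E j" using 1 by simp
      then show ?thesis using 2 3 4 by (intro disjI2 mat22_eqI) (simp_all add: B_def)
    qed
    then have "abs_psl2r A = core_placement n m j l"
      unfolding placement by (subst abs_psl2r_eq_iff[OF 4(2) detB]) auto
    then show "A \<in> {A. det A = 1 \<and> abs_psl2r A \<in> standard_tiling n m}"
      using 4 by (auto simp: standard_tiling_eq[OF assms])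
  next
    fix A assume "A \<in> {A. det A = 1 \<and> abs_psl2r A \<in> standard_tiling n m}"
    then obtain j l where d: "det A = 1" and "abs_psl2r A = abs_psl2r (B j l)"
      by (auto simp: standard_tiling_eq[OF assms] placement)
    then have "A = B j l \<or> A = - B j l"
      using abs_psl2r_eq_iff[OF detB d, of j l] by auto
    then have "\<bar>A$1$1\<bar> = E j" "A$1$2 / (?c * A$1$1) = of_int l" "A$2$1 = 0"
      using E[of j] c by (auto simp: B_def)
    moreover from this have "2 * ln \<bar>A$1$1\<bar> / ?L = of_int j"
      using L by (simp add: E_def)
    ultimately show "A \<in> Z" using d by (simp add: Z_def D_def)
  qed
  finally show ?thesis by (simp add: closed_psl2r_iff)
qed

section \<open>Every tiling zooms to the standard one\<close>

lemma height_of_level_core: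
  assumes "n \<ge> 3" "m \<ge> 2" "moebius h ` core n m = level_core n m j c l"
  shows "real m powi j \<le> height h \<and> height h \<le> real m powi (j + 1)"
  using i_in_core[OF assms(2,1)] assms(3) by (force simp: height_def level_core_def)

lemma powi_less_powi_iff:
  assumes "m \<ge> 2"
  shows "real m powi i < real m powi j \<longleftrightarrow> i < j"
  using assms by (simp add: powi_eq_exp)

lemma mem_translate_iff:
  assumes "k * g = 1" "g * k = 1"
  shows "h \<in> translate k F \<longleftrightarrow> g * h \<in> F"
proof
  assume "h \<in> translate k F"
  then show "g * h \<in> F" using assms(2) by (auto simp: translate_def simp flip: mult.assoc)
next
  assume "g * h \<in> F"
  moreover have "h = k * (g * h)" using assms(1) by (simp flip: mult.assoc)
  ultimately show "h \<in> translate k F" unfolding translate_def by (metis image_eqI)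
qed

lemma congruent_from_steps:
  fixes c :: "nat \<Rightarrow> real"
  assumes "\<And>j. \<exists>k :: int. c (Suc j) - c j = real m ^ Suc j * of_int k" "i \<le> N"
  shows "\<exists>q :: int. c N = c i + real m ^ Suc i * of_int q"
  using assms(2)
proof (induction N rule: dec_induct)
  case base
  show ?case by (rule exI[of _ 0]) simp
next
  case (step N)
  then obtain q :: int where "c N = c i + real m ^ Suc i * of_int q" by blast
  moreover obtain k :: int where "c (Suc N) - c N = real m ^ Suc N * of_int k" using assms(1) by blast
  moreover have "real m ^ Suc N = real m ^ Suc i * of_int (int m ^ (N - i))"
    using step(1) by (simp flip: power_add)
  ultimately have "c (Suc N) = c i + real m ^ Suc i * of_int (q + int m ^ (N - i) * k)"
    by (simp add: algebra_simps)
  then show ?case by blast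
qed

text \<open>Suppose that, as seen from \<open>g\<close>, the cores above height \<open>1\<close> are those of a
half-plane tiling with offsets \<open>c\<close>. Move \<open>c (2 * M)\<close> to the origin and shrink by \<open>m ^ M\<close>. All levels up to
\<open>2 * M\<close> then have offsets congruent to zero, and they become the levels from \<open>- M\<close> to
\<open>M\<close>; everything else is moved below height \<open>m powi (- M)\<close> or above \<open>m powi M\<close>.\<close>

lemma zoom_to_standard_tiling:
  fixes c :: "nat \<Rightarrow> real" and M :: nat
  assumes nm: "n \<ge> 3" "m \<ge> 2"
    and c: "\<And>j. \<exists>k :: int. c (Suc j) - c j = real m ^ Suc j * of_int k"
    and C1: "\<And>j l. moebius g ` level_core n m (int j) (c j) l \<in> C"
    and C2: "\<And>h. 1 < height h \<Longrightarrow> moebius (g * h) ` core n m \<in> C \<Longrightarrow>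
      \<exists>j l. moebius h ` core n m = level_core n m (int j) (c j) l"
  shows "\<exists>k. \<forall>h. real m powi (- int M) < height h \<and> height h < real m powi int M \<longrightarrow>
    (h \<in> translate k (placements n m C) \<longleftrightarrow> h \<in> standard_tiling n m)"
proof -
  define N where "N = 2 * M"
  define u where "u = scale_shift (of_int (int M) * ln (real m)) (hecke_lambda n * c N)"
  have u_image: "moebius u ` level_core n m j 0 l = level_core n m (int M + j) (c N) l" for j l
    using scale_shift_image_level_core[OF nm(2), of "int M" n "c N" j 0 l] by (simp add: u_def)
  have u_height: "height (u * h) = real m powi int M * height h" for h
    using powi_eq_exp[of "real m" "int M"] nm by (simp only: u_def height_scale_shift_mult)
  have renumber: "\<exists>q. \<forall>l. level_core n m (int i) (c N) l = level_core n m (int i) (c i) (l + q)"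
    if iN: "i \<le> N" for i
  proof -
    obtain q :: int where "c N = c i + real m ^ Suc i * of_int q"
      using congruent_from_steps[of c m i N, OF c iN] by blast
    moreover have "real m ^ Suc i = real m powi (int i + 1)"
      by (simp add: power_int_def nat_add_distrib)
    ultimately show ?thesis using level_core_shift by metis
  qed
  obtain k where k: "k * (g * u) = 1" "(g * u) * k = 1" using psl2r_inverse by blast
  show ?thesis
  proof (intro exI allI impI)
    fix h assume h: "real m powi (- int M) < height h \<and> height h < real m powi int M"
    have "h \<in> translate k (placements n m C) \<longleftrightarrow> moebius (g * (u * h)) ` core n m \<in> C"
      by (simp add: mem_translate_iff[OF k] placements_def mult.assoc)
    also have "\<dots> \<longleftrightarrow> h \<in> standard_tiling n m"
    proof
      assume "h \<in> standard_tiling n m"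
      then obtain j l where jl: "moebius h ` core n m = level_core n m j 0 l"
        by (auto simp: standard_tiling_def placements_def)
      from height_of_level_core[OF nm this] h
      have "real m powi j < real m powi int M" "real m powi (- int M) < real m powi (j + 1)" by linarith+
      then have "j < int M" "- int M < j + 1" by (simp_all only: powi_less_powi_iff[OF nm(2)])
      \<comment> \<open>The level \<open>j\<close> comes from the level \<open>M + j\<close>, which lies between \<open>0\<close> and \<open>2 * M\<close>.\<close>
      then have i: "int M + j = int (nat (int M + j))" "nat (int M + j) \<le> N"
        by (auto simp: N_def)
      have "moebius (g * (u * h)) ` core n m = moebius g ` level_core n m (int M + j) (c N) l"
        unfolding moebius_image_mult[OF core_upper] jl u_image by (rule refl)
      then show "moebius (g * (u * h)) ` core n m \<in> C"
        using renumber[OF i(2)] C1 i(1) by metis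
    next
      assume A: "moebius (g * (u * h)) ` core n m \<in> C"
      have pos: "real m powi int M > 0" using nm by simp
      have "real m powi int M * real m powi (- int M) < real m powi int M * height h"
        "real m powi int M * height h < real m powi int M * real m powi int M"
        using mult_strict_left_mono[OF conjunct1[OF h] pos] mult_strict_left_mono[OF conjunct2[OF h] pos]
        by blast+
      moreover have "real m powi int M * real m powi (- int M) = 1"
        using nm by (simp add: power_int_minus)
      moreover have "real m powi int M * real m powi int M = real m powi (2 * int M)"
        using nm power_int_add[of "real m" "int M" "int M"] by (simp only: mult_2) simp
      ultimately have hu: "1 < height (u * h)" "height (u * h) < real m powi (2 * int M)"
        unfolding u_height by linarith+
      from C2[OF hu(1) A] obtain j l where
        jl: "moebius (u * h) ` core n m = level_core n m (int j) (c j) l" by blast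
      have "real m powi int j < real m powi (2 * int M)"
        using height_of_level_core[OF nm jl] hu(2) by linarith
      then have "int j < 2 * int M" by (simp only: powi_less_powi_iff[OF nm(2)])
      then have "j \<le> N" by (simp add: N_def)
      then obtain q where q: "\<And>l. level_core n m (int j) (c N) l = level_core n m (int j) (c j) (l + q)"
        using renumber by blast
      have "moebius u ` moebius h ` core n m = level_core n m (int j) (c N) (l - q)"
        using jl q[of "l - q"] by (simp add: moebius_image_mult core_upper)
      also have "\<dots> = moebius u ` level_core n m (int j - int M) 0 (l - q)"
        by (simp add: u_image)
      finally have "moebius h ` core n m = level_core n m (int j - int M) 0 (l - q)"
        by (simp add: moebius_image_eq_iff moebius_image_upper core_upper level_core_upper nm)
      then show "h \<in> standard_tiling n m"
        by (auto simp: standard_tiling_def placements_def)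
    qed
    finally show "h \<in> translate k (placements n m C) \<longleftrightarrow> h \<in> standard_tiling n m" .
  qed
qed

text \<open>In a nondegenerate tiling pick any horoball and look at it with its boundary at height \<open>1\<close>. A core
that meets a height greater than \<open>1\<close> belongs to this horoball: a core of another horoball meets it in tangency
points only, and these have height \<open>1\<close>. The separation of the horoballs is thus read off from the position of their
tangency points. In a degenerate tiling
levels of negative index do not reach above height \<open>1\<close>.\<close>

lemma tiling_zooms_to_standard_tiling:
  assumes nm: "n \<ge> 3" "m \<ge> 2" and F: "F \<in> tilings n m"
  shows "\<exists>k. \<forall>h. real m powi (- int M) < height h \<and> height h < real m powi int M \<longrightarrow>
    (h \<in> translate k F \<longleftrightarrow> h \<in> standard_tiling n m)"
proof -
  obtain C where FC: "F = placements n m C" and "nondegenerate_cores n m C \<or> degenerate_cores n m C"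
    using F by (auto simp: tilings_def)
  then consider "nondegenerate_cores n m C" | "degenerate_cores n m C" by blast
  then show ?thesis
  proof cases
    case 1
    then obtain g0 P D where P: "P = {moebius g0 ` B | B. B \<in> hecke_packing n}"
      and PD: "\<And>B. B \<in> P \<Longrightarrow> horoball_tiling n m P B (D B)" and C: "C = (\<Union>B\<in>P. D B)"
      unfolding nondegenerate_cores_def by blast
    have "1 \<in> hecke_group n"
      using generate.one[of PSL2R] by (simp add: hecke_group_def PSL2R_def)
    then obtain B where B: "B \<in> P"
      unfolding P hecke_packing_def by blast
    from PD[OF B] obtain g and c :: "nat \<Rightarrow> int" where
      gB: "moebius g ` std_horoball = B"
      and gt: "moebius g ` {\<i> + of_real (of_int l * hecke_lambda n) | l :: int. True} = tangency_points P B"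
      and c: "\<And>j. [c (j + 1) = c j] (mod (int m ^ (j + 1)))"
      and DB: "D B = {moebius g ` level_core n m (int j) (of_int (c j)) l | (j :: nat) (l :: int). True}"
      unfolding horoball_tiling_def by blast
    have "\<exists>k :: int. real_of_int (c (Suc j)) - real_of_int (c j) = real m ^ Suc j * of_int k" for j
    proof -
      from c[of j] obtain k where "c (Suc j) - c j = int m ^ Suc j * k"
        by (auto simp: cong_iff_dvd_diff dvd_def)
      then have "real_of_int (c (Suc j) - c j) = real_of_int (int m ^ Suc j * k)" by simp
      then show ?thesis by (intro exI[of _ k]) simp
    qed
    moreover have "moebius g ` level_core n m (int j) (of_int (c j)) l \<in> C" for j l
    proof -
      have "moebius g ` level_core n m (int j) (of_int (c j)) l \<in> D B" unfolding DB by blast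
      with B show ?thesis unfolding C by blast
    qed
    moreover have "\<exists>j l. moebius h ` core n m = level_core n m (int j) (of_int (c j)) l"
      if h: "1 < height h" and hC: "moebius (g * h) ` core n m \<in> C" for h
    proof -
      from hC obtain B' where B': "B' \<in> P" "moebius (g * h) ` core n m \<in> D B'"
        unfolding C by blast
      have "B' = B"
      proof (rule ccontr)
        assume "B' \<noteq> B"
        from PD[OF B'(1)] obtain g' and c' :: "nat \<Rightarrow> int" where
          g': "moebius g' ` std_horoball = B'"
          and DB': "D B' = {moebius g' ` level_core n m (int j) (of_int (c' j)) l | (j :: nat) (l :: int). True}"
          unfolding horoball_tiling_def by (elim exE conjE)
        from B'(2) obtain j l where
          "moebius (g * h) ` core n m = moebius g' ` level_core n m (int j) (of_int (c' j)) l"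
          unfolding DB' by blast
        moreover have "level_core n m (int j) b l \<subseteq> std_horoball" for b
        proof -
          have "1 \<le> real m powi int j" using nm by simp
          then show ?thesis by (auto simp: level_core_def std_horoball_def)
        qed
        ultimately have "moebius (g * h) ` core n m \<subseteq> B'"
          unfolding g'[symmetric] by (simp add: image_mono)
        then have "moebius (g * h) \<i> \<in> B'" using i_in_core nm by blast
        moreover have gh: "moebius (g * h) \<i> = moebius g (moebius h \<i>)"
          by (simp add: moebius_mult)
        moreover have "moebius h \<i> \<in> std_horoball"
          using h by (simp add: std_horoball_def height_def)
        ultimately have "moebius g (moebius h \<i>) \<in> tangency_points P B"
          using B'(1) \<open>B' \<noteq> B\<close> gB by (auto simp: tangency_points_def)
        then obtain l :: int where "moebius g (moebius h \<i>) = moebius g (\<i> + of_real (of_int l * hecke_lambda n))"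
          unfolding gt[symmetric] by blast
        then have "moebius h \<i> = \<i> + of_real (of_int l * hecke_lambda n)"
          by (rule moebius_inj) (simp_all add: Im_moebius_pos)
        then have "height h = 1" by (simp add: height_def)
        with h show False by simp
      qed
      with B'(2) have "moebius (g * h) ` core n m \<in> D B" by simp
      then obtain j l where
        "moebius g ` moebius h ` core n m = moebius g ` level_core n m (int j) (of_int (c j)) l"
        unfolding DB moebius_image_mult[OF core_upper] by blast
      then show ?thesis
        by (auto simp: moebius_image_eq_iff moebius_image_upper core_upper level_core_upper nm)
    qed
    ultimately show ?thesis
      unfolding FC by (rule zoom_to_standard_tiling[OF nm])
  next
    case 2
    then obtain g and c :: "int \<Rightarrow> real" where
      c: "\<And>j. \<exists>k :: int. c (j + 1) - c j = real m powi (j + 1) * of_int k"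
      and C: "C = {moebius g ` level_core n m j (c j) l | j l. True}"
      unfolding degenerate_cores_def by blast
    have "\<exists>k :: int. c (int (Suc j)) - c (int j) = real m ^ Suc j * of_int k" for j
    proof -
      have "real m powi (int j + 1) = real m ^ Suc j"
        by (simp add: power_int_def nat_add_distrib)
      then show ?thesis using c[of "int j"] by (simp add: add.commute)
    qed
    moreover have "moebius g ` level_core n m (int j) (c (int j)) l \<in> C" for j l
      unfolding C by blast
    moreover have "\<exists>j l. moebius h ` core n m = level_core n m (int j) (c (int j)) l"
      if h: "1 < height h" and hC: "moebius (g * h) ` core n m \<in> C" for h
    proof -
      from hC obtain j l where
        "moebius g ` moebius h ` core n m = moebius g ` level_core n m j (c j) l"
        unfolding C moebius_image_mult[OF core_upper] by blast
      then have jl: "moebius h ` core n m = level_core n m j (c j) l"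
        by (simp add: moebius_image_eq_iff moebius_image_upper core_upper level_core_upper nm)
      have "real m powi 0 < real m powi (j + 1)"
        using height_of_level_core[OF nm jl] h by simp
      then have "0 < j + 1" by (simp only: powi_less_powi_iff[OF nm(2)])
      then have "j = int (nat j)" by simp
      with jl show ?thesis by metis
    qed
    ultimately show ?thesis
      unfolding FC by (rule zoom_to_standard_tiling[OF nm])
  qed
qed
text \<open>Translates of any member agree with the standard tiling on any given compact set, by
\<open>tiling_zooms_to_standard_tiling\<close>, so they converge to it.\<close>

lemma standard_tiling_in_closed_invariant:
  assumes nm: "n \<ge> 3" "m \<ge> 2"
    and X: "X \<subseteq> tilings n m" "X \<noteq> {}" "invariant translate X" "closedin (tiling_space n m) X"
  shows "standard_tiling n m \<in> X"
proof (rule ccontr)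
  let ?T = "standard_tiling n m"
  assume "?T \<notin> X"
  obtain C where C: "closedin fell_topology C" "X = C \<inter> tilings n m"
    using X(4) by (auto simp: tiling_space_def closedin_subtopology)
  have "openin fell_topology (topspace fell_topology - C)"
    using C(1) by (simp add: closedin_def)
  moreover have "?T \<in> topspace fell_topology - C"
    using \<open>?T \<notin> X\<close> C(2) standard_tiling_in_tilings closed_standard_tiling[OF nm]
    by (simp add: topspace_fell_topology)
  ultimately obtain K where K: "compact K"
    "\<And>F. closed F \<Longrightarrow> F \<inter> K = ?T \<inter> K \<Longrightarrow> F \<in> topspace fell_topology - C"
    using fell_neighbourhood_compact by (metis (no_types, lifting))
  obtain M where M: "\<And>h. h \<in> K \<Longrightarrow> real m powi (- int M) < height h \<and> height h < real m powi int M"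
    using compact_height_bounds[OF K(1), of "real m"] nm(2) by auto
  obtain F where F: "F \<in> X" using X(2) by blast
  \<comment> \<open>The strip of heights belonging to \<open>M\<close> contains \<open>K\<close>.\<close>
  then obtain k where k: "\<And>h. real m powi (- int M) < height h \<and> height h < real m powi int M \<Longrightarrow>
      h \<in> translate k F \<longleftrightarrow> h \<in> ?T"
    using tiling_zooms_to_standard_tiling[OF nm, of F M] X(1) by blast
  have kF: "translate k F \<in> X"
    using X(3) F by (simp add: invariant_def)
  then have "translate k F \<in> C" using C(2) by blast
  then have "closed (translate k F)"
    using closedin_subset[OF C(1)] by (auto simp: topspace_fell_topology)
  moreover have "translate k F \<inter> K = ?T \<inter> K" using M k by blast
  ultimately show False using K(2) \<open>translate k F \<in> C\<close> by blast
qed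

section \<open>Tilings whose relative traces lie in the length spectrum\<close>

text \<open>The absolute traces of hyperbolic elements whose translation length is a multiple of \<open>ln m\<close>, together
with the parabolic value \<open>2\<close> for \<open>k = 0\<close>.\<close>

definition trace_spectrum :: "nat \<Rightarrow> real set" where
  "trace_spectrum m = {2 * cosh (of_int k * ln (real m) / 2) | k. True}"

lemma closed_trace_spectrum:
  assumes "m \<ge> 2"
  shows "closed (trace_spectrum m)"
proof -
  let ?f = "\<lambda>x::real. 2 * arcosh (x / 2) / ln (real m)"
  have L: "ln (real m) > 0" using assms by simp
  have "closed ({2..} \<inter> ?f -` \<int>)"
    using L by (intro continuous_closed_preimage continuous_intros closed_Ints) auto
  also have "{2..} \<inter> ?f -` \<int> = trace_spectrum m"
  proof (intro subset_antisym subsetI)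
    fix x assume "x \<in> {2..} \<inter> ?f -` \<int>"
    then obtain k where "x \<ge> 2" "?f x = of_int k" by (auto elim: Ints_cases)
    then have "arcosh (x / 2) = of_int k * ln (real m) / 2" using L by (simp add: field_simps)
    then have "cosh (arcosh (x / 2)) = cosh (of_int k * ln (real m) / 2)" by (rule arg_cong)
    then have "x = 2 * cosh (of_int k * ln (real m) / 2)"
      using \<open>x \<ge> 2\<close> by (simp add: cosh_arcosh_real)
    then show "x \<in> trace_spectrum m" by (auto simp: trace_spectrum_def)
  next
    fix x assume "x \<in> trace_spectrum m"
    then obtain k :: int where x: "x = 2 * cosh (of_int k * ln (real m) / 2)"
      by (auto simp: trace_spectrum_def)
    have "cosh (of_int k * ln (real m) / 2) = cosh (of_int \<bar>k\<bar> * ln (real m) / 2)"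
      using cosh_real_abs[of "of_int k * ln (real m) / 2"] L by (simp add: abs_mult)
    moreover have "0 \<le> of_int \<bar>k\<bar> * ln (real m) / 2" using L by simp
    ultimately have "arcosh (x / 2) = of_int \<bar>k\<bar> * ln (real m) / 2"
      using arcosh_cosh_real unfolding x by (metis nonzero_mult_div_cancel_left zero_neq_numeral)
    then have "?f x = of_int \<bar>k\<bar>" using L by (simp add: field_simps)
    moreover have "x \<ge> 2" using cosh_real_ge_1 by (simp add: x)
    ultimately show "x \<in> {2..} \<inter> ?f -` \<int>" by simp
  qed
  finally show ?thesis .
qed

text \<open>A closed invariant condition that holds for degenerate tilings and still forces the translation
lengths of hyperbolic symmetries into the multiples of \<open>ln m\<close>. It is closed because it concerns only two
placements at a time.\<close>

definition traces_in_spectrum :: "nat \<Rightarrow> psl2r set \<Rightarrow> bool" where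
  "traces_in_spectrum m F \<longleftrightarrow> (\<forall>g\<in>F. \<forall>h\<in>F. rel_trace g h \<in> trace_spectrum m)"

lemma traces_in_spectrum_translate: "traces_in_spectrum m F \<Longrightarrow> traces_in_spectrum m (translate k F)"
  by (auto simp: traces_in_spectrum_def translate_def rel_trace_mult_left)

lemma traces_in_spectrum_standard_tiling:
  assumes "n \<ge> 3" "m \<ge> 2"
  shows "traces_in_spectrum m (standard_tiling n m)"
proof -
  have "(of_int j' * L - of_int j * L) / 2 = of_int (j' - j) * L / 2" for j j' and L :: real
    by (simp add: algebra_simps)
  then show ?thesis
    unfolding traces_in_spectrum_def standard_tiling_eq[OF assms] core_placement_def trace_spectrum_def
    by (auto simp only: rel_trace_scale_shift mem_Collect_eq)
qed

text \<open>Joint continuity of the relative trace. It is obtained from the continuity on pairs of matrices, since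
images of open sets of matrices are open.\<close>

lemma rel_trace_notin_neighbourhoods:
  assumes "closed R" "rel_trace g h \<notin> R"
  obtains U V where "open U" "open V" "g \<in> U" "h \<in> V" "\<And>g' h'. g' \<in> U \<Longrightarrow> h' \<in> V \<Longrightarrow> rel_trace g' h' \<notin> R"
proof -
  let ?S = "{A :: real^2^2. det A = 1}"
  let ?t = "\<lambda>(A :: real^2^2, B :: real^2^2). \<bar>A$2$2 * B$1$1 - A$1$2 * B$2$1 - A$2$1 * B$1$2 + A$1$1 * B$2$2\<bar>"
  obtain A where A: "det A = 1" "g = abs_psl2r A" by (induct g rule: psl2r.abs_induct) auto
  obtain B where B: "det B = 1" "h = abs_psl2r B" by (induct h rule: psl2r.abs_induct) auto
  have t: "rel_trace (abs_psl2r A) (abs_psl2r B) = ?t (A, B)" if "det A = 1" "det B = 1" for A B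
    using that by (simp add: rel_trace.abs_eq eq_onp_def)
  have op: "open (?t -` (- R))"
    using assms(1) unfolding case_prod_unfold
    by (intro open_vimage continuous_intros) (auto simp: open_Compl)
  have "rel_trace g h = ?t (A, B)" unfolding A(2) B(2) by (rule t[OF A(1) B(1)])
  then have mem: "(A, B) \<in> ?t -` (- R)" using assms(2) by (simp only: vimage_eq Compl_iff not_False_eq_True)
  obtain U V where UV: "open U" "open V" "(A, B) \<in> U \<times> V" "U \<times> V \<subseteq> ?t -` (- R)"
    by (rule open_prod_elim[OF op mem])
  show thesis
  proof
    show "open (abs_psl2r ` (?S \<inter> U))" "open (abs_psl2r ` (?S \<inter> V))"
      using UV by (auto intro!: open_abs_image openin_open_Int)
    show "g \<in> abs_psl2r ` (?S \<inter> U)" "h \<in> abs_psl2r ` (?S \<inter> V)"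
      using A B UV by auto
    fix g' h' assume "g' \<in> abs_psl2r ` (?S \<inter> U)" "h' \<in> abs_psl2r ` (?S \<inter> V)"
    then obtain A' B' where A': "g' = abs_psl2r A'" "det A' = 1" "A' \<in> U"
      and B': "h' = abs_psl2r B'" "det B' = 1" "B' \<in> V" by auto
    have "(A', B') \<in> ?t -` (- R)" by (rule subsetD[OF UV(4)]) (use A' B' in blast)
    then show "rel_trace g' h' \<notin> R"
      unfolding A'(1) B'(1) t[OF A'(2) B'(2)] by (simp only: vimage_eq Compl_iff not_False_eq_True)
  qed
qed

text \<open>A violation of the condition by two elements \<open>g\<close>, \<open>h\<close> persists for all closed sets that meet small neighbourhoods
of both.\<close>

lemma closedin_traces_in_spectrum:
  assumes "m \<ge> 2"
  shows "closedin fell_topology {F. closed F \<and> traces_in_spectrum m F}"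
proof -
  have "openin fell_topology (topspace fell_topology - {F. closed F \<and> traces_in_spectrum m F})"
  proof (subst openin_subopen, intro ballI)
    fix F assume "F \<in> topspace fell_topology - {F. closed F \<and> traces_in_spectrum m F}"
    then obtain g h where F: "closed F" "g \<in> F" "h \<in> F" "rel_trace g h \<notin> trace_spectrum m"
      by (auto simp: topspace_fell_topology traces_in_spectrum_def)
    obtain U V where UV: "open U" "open V" "g \<in> U" "h \<in> V"
      "\<And>g' h'. g' \<in> U \<Longrightarrow> h' \<in> V \<Longrightarrow> rel_trace g' h' \<notin> trace_spectrum m"
      using rel_trace_notin_neighbourhoods[OF closed_trace_spectrum[OF assms] F(4)] by blast
    let ?W = "{F. closed F \<and> F \<inter> U \<noteq> {}} \<inter> {F. closed F \<and> F \<inter> V \<noteq> {}}"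
    have "openin fell_topology ?W"
      using UV(1,2) unfolding fell_topology_def
      by (intro openin_Int topology_generated_by_Basis) auto
    moreover have "F \<in> ?W" using F UV by blast
    moreover have "?W \<subseteq> topspace fell_topology - {F. closed F \<and> traces_in_spectrum m F}"
      using UV(5) by (auto simp: topspace_fell_topology traces_in_spectrum_def)
    ultimately show "\<exists>W. openin fell_topology W \<and> F \<in> W \<and>
        W \<subseteq> topspace fell_topology - {F. closed F \<and> traces_in_spectrum m F}" by blast
  qed
  then show ?thesis
    by (auto simp: closedin_def topspace_fell_topology)
qed

section \<open>Comparing the scaling factors\<close>

text \<open>A symmetry moves a placement to another placement, so its trace is a relative trace; hence
\<open>ln m'\<close> is a positive integer multiple of \<open>ln m\<close>.\<close>

lemma le_if_traces_in_spectrum_fixed_by_scaling: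
  assumes "m \<ge> 2" "m' \<ge> 2" "traces_in_spectrum m F" "F \<noteq> {}" "translate (scale_shift (ln (real m')) 0) F = F"
  shows "m \<le> m'"
proof -
  let ?a = "scale_shift (ln (real m')) 0"
  obtain g where g: "g \<in> F" using assms(4) by blast
  then have "?a * g \<in> translate ?a F" unfolding translate_def by (rule imageI)
  then have "?a * g \<in> F" unfolding assms(5) .
  with g have "rel_trace g (?a * g) \<in> trace_spectrum m" using assms(3) by (simp add: traces_in_spectrum_def)
  moreover have "rel_trace g (?a * g) = 2 * cosh (ln (real m') / 2)"
    unfolding rel_trace_conj scale_shift_0_0[symmetric] rel_trace_scale_shift by simp
  ultimately obtain k :: int where k: "cosh (ln (real m') / 2) = cosh (of_int k * ln (real m) / 2)"
    by (auto simp: trace_spectrum_def)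
  have L: "ln (real m) > 0" "ln (real m') > 0" using assms by auto
  have "\<bar>ln (real m') / 2\<bar> = \<bar>of_int k * ln (real m) / 2\<bar>"
    using k by (metis arcosh_cosh_real cosh_real_abs abs_ge_zero)
  then have eq: "ln (real m') = of_int \<bar>k\<bar> * ln (real m)" using L by (simp add: abs_mult)
  with L have "k \<noteq> 0" by auto
  then have "of_int \<bar>k\<bar> \<ge> (1 :: real)" by linarith
  then have "ln (real m) \<le> ln (real m')" unfolding eq using L by simp
  then show ?thesis using assms by simp
qed

text \<open>The conjugacy takes the tilings in \<open>X\<close> with relative traces in the spectrum of \<open>m\<close> to a nonempty closed invariant set
in \<open>Y\<close>, which must contain the standard tiling for \<open>m'\<close>; the preimage of this tiling inherits the symmetry
\<open>z \<mapsto> m' * z\<close>.\<close>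

lemma conjugate_imp_le:
  assumes nm: "n \<ge> 3" "n' \<ge> 3" "m \<ge> 2" "m' \<ge> 2"
    and X: "X \<subseteq> tilings n m" "X \<noteq> {}" "invariant translate X" "closedin (tiling_space n m) X"
    and Y: "Y \<subseteq> tilings n' m'" "Y \<noteq> {}" "invariant translate Y" "closedin (tiling_space n' m') Y"
    and conj: "topologically_conjugate translate (subtopology (tiling_space n m) X)
             translate (subtopology (tiling_space n' m') Y)"
  shows "m \<le> m'"
proof -
  let ?X = "subtopology (tiling_space n m) X" and ?Y = "subtopology (tiling_space n' m') Y"
  let ?a = "scale_shift (ln (real m')) 0"
  have top: "topspace ?X = X" "topspace ?Y = Y"
    using closedin_subset[OF X(4)] closedin_subset[OF Y(4)] by (auto simp: topspace_subtopology)
  obtain f where f: "homeomorphic_map ?X ?Y f" "\<And>g x. x \<in> X \<Longrightarrow> f (translate g x) = translate g (f x)"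
    using conj unfolding topologically_conjugate_def top by blast
  define Z where "Z = {F \<in> X. traces_in_spectrum m F}"
  have "X \<subseteq> {F. closed F}"
    using closedin_subset[OF X(4)] by (auto simp: tiling_space_def topspace_fell_topology)
  then have "Z = {F. closed F \<and> traces_in_spectrum m F} \<inter> X" by (auto simp: Z_def)
  moreover have "?X = subtopology fell_topology X"
    using X(1) by (simp add: tiling_space_def subtopology_subtopology Int_absorb1)
  ultimately have "closedin ?X Z"
    using closedin_traces_in_spectrum[OF nm(3)] by (auto simp: closedin_subtopology)
  then have "closedin ?Y (f ` Z)"
    using homeomorphic_imp_closed_map[OF f(1)] by (simp add: closed_map_def)
  then have "closedin (tiling_space n' m') (f ` Z)"
    using closedin_trans_full[OF _ Y(4)] by blast
  moreover have ZX: "Z \<subseteq> X" by (auto simp: Z_def)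
  have "f ` X = Y" using homeomorphic_imp_surjective_map[OF f(1)] top by simp
  then have "f ` Z \<subseteq> tilings n' m'" using ZX Y(1) by blast
  moreover have "standard_tiling n m \<in> Z"
    using standard_tiling_in_closed_invariant[OF nm(1,3) X] traces_in_spectrum_standard_tiling[OF nm(1,3)]
    by (simp add: Z_def)
  then have "f ` Z \<noteq> {}" by blast
  moreover have "invariant translate (f ` Z)"
    unfolding invariant_def
  proof (intro allI ballI)
    fix g y assume "y \<in> f ` Z"
    then obtain F where F: "F \<in> Z" "y = f F" by blast
    have "translate g F \<in> Z"
      using F(1) X(3) traces_in_spectrum_translate by (auto simp: Z_def invariant_def)
    moreover have "f (translate g F) = translate g y"
      using f(2) F ZX by blast
    ultimately show "translate g y \<in> f ` Z" by (metis imageI)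
  qed
  ultimately have "standard_tiling n' m' \<in> f ` Z"
    by (intro standard_tiling_in_closed_invariant nm)
  then obtain F where F: "F \<in> Z" "f F = standard_tiling n' m'" by auto
  have "f (translate ?a F) = f F"
    using f(2) F ZX scaling_fixes_standard_tiling[OF nm(2,4)] by auto
  moreover have "inj_on f X" using homeomorphic_imp_injective_map[OF f(1)] top by simp
  moreover have "translate ?a F \<in> X" "F \<in> X" using F ZX X(3) by (auto simp: invariant_def)
  ultimately have "translate ?a F = F" by (simp add: inj_on_def)
  \<comment> \<open>A translate of \<open>F\<close> agrees with the standard tiling at the identity, which places its core
    of level \<open>0\<close> and number \<open>0\<close>.\<close>
  moreover have "F \<noteq> {}"
  proof
    assume "F = {}"
    have "scale_shift 0 0 = core_placement n m 0 0" by (simp add: core_placement_def)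
    then have "1 \<in> standard_tiling n m"
      unfolding standard_tiling_eq[OF nm(1,3)] scale_shift_0_0 by blast
    moreover have "real m powi (- int 1) < height 1 \<and> height 1 < real m powi int 1"
      using nm(3) by (simp add: height_def power_int_minus field_simps)
    ultimately obtain k where "1 \<in> translate k F"
      using tiling_zooms_to_standard_tiling[OF nm(1,3), of F 1] F(1) ZX X(1) by blast
    then show False using \<open>F = {}\<close> by (simp add: translate_def)
  qed
  moreover have "traces_in_spectrum m F" using F(1) by (simp add: Z_def)
  ultimately show ?thesis
    by (intro le_if_traces_in_spectrum_fixed_by_scaling[OF nm(3,4), of F])
qed

lemma topologically_conjugate_sym:
  assumes "topologically_conjugate act1 X act2 Y" "\<And>g x. x \<in> topspace X \<Longrightarrow> act1 g x \<in> topspace X"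
  shows "topologically_conjugate act2 Y act1 X"
proof -
  obtain f where f: "homeomorphic_map X Y f" "\<And>g x. x \<in> topspace X \<Longrightarrow> f (act1 g x) = act2 g (f x)"
    using assms(1) unfolding topologically_conjugate_def by blast
  then obtain h where h: "homeomorphic_maps X Y f h" by (auto simp: homeomorphic_map_maps)
  have "h (act2 g y) = act1 g (h y)" if "y \<in> topspace Y" for g y
  proof -
    have "h y \<in> topspace X" "f (h y) = y"
      using h that by (auto simp: homeomorphic_maps_def continuous_map_def Pi_iff)
    then have "act2 g y = f (act1 g (h y))" using f(2) by simp
    then show ?thesis
      using h assms(2)[OF \<open>h y \<in> topspace X\<close>] by (simp add: homeomorphic_maps_def)
  qed
  moreover have "homeomorphic_map Y X h" using h homeomorphic_maps_sym homeomorphic_maps_map by blast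
  ultimately show ?thesis unfolding topologically_conjugate_def by blast
qed

theorem theorem10:
  fixes n n' m m' :: nat and X Y :: "psl2r set set"
  assumes "n \<ge> 3" "n' \<ge> 3" "m \<ge> 2" "m' \<ge> 2"
    and "X \<subseteq> tilings n m" "X \<noteq> {}" "invariant translate X" "closedin (tiling_space n m) X"
    and "Y \<subseteq> tilings n' m'" "Y \<noteq> {}" "invariant translate Y" "closedin (tiling_space n' m') Y"
    and "m \<noteq> m'"
  shows "\<not> topologically_conjugate translate (subtopology (tiling_space n m) X)
             translate (subtopology (tiling_space n' m') Y)"
proof
  assume conj: "topologically_conjugate translate (subtopology (tiling_space n m) X)
             translate (subtopology (tiling_space n' m') Y)"
  have "topspace (subtopology (tiling_space n m) X) = X"
    using closedin_subset[OF assms(8)] by (auto simp: topspace_subtopology)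
  then have "topologically_conjugate translate (subtopology (tiling_space n' m') Y)
             translate (subtopology (tiling_space n m) X)"
    using assms(7) by (intro topologically_conjugate_sym[OF conj]) (simp add: invariant_def)
  then have "m' \<le> m"
    using conjugate_imp_le[OF assms(2,1,4,3,9-12,5-8)] by blast
  moreover have "m \<le> m'"
    using conjugate_imp_le[OF assms(1-12) conj] .
  ultimately show False using assms(13) by simp
qed

end
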